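(* There exists a smooth complete rotationally symmetric Riemannian metric $g=dr^2+\phi(r)^2\,d\theta^2$ on $\mathbb{R}^2$ (in polar coordinates $(r,\theta)$) such that: (a) the volume doubling condition fails: there is no constant $\kappa$ such that $\mathrm{Vol}(B_{2R})\le\kappa\,\mathrm{Vol}(B_R)$ for all $R>0$ and all pairs of concentric geodesic balls $B_R\subset B_{2R}$ of radii $R$ and $2R$; (b) Liouville's theorem holds: every bounded harmonic function on $(\mathbb{R}^2,g)$ is constant; (c) the Strong Liouville Property holds: for every positive integer $d$, the space $\mathcal{H}_d$ is finite-dimensional.
   Context: Harmonic means $\Delta_g u=0$, where $\Delta_g=\partial_r^2+\frac{\phi'}{\phi}\partial_r+\frac{1}{\phi^2}\partial_\theta^2$ for $r>0$. For a positive integer $d$, $\mathcal{H}_d$ is the real vector space of harmonic functions $u:\mathbb{R}^2\to\mathbb{R}$ with $\sup_{x}\frac{|u(x)|}{(1+|x|)^d}<\infty$, where $|x|$ is the $g$-distance from $x$ to the origin (so $|x|=r$). *)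

theory Defs
  imports "HOL-Analysis.Analysis"
begin

text \<open>Functions of class \<open>C\<^sup>k\<close> on the whole space: all iterated directional derivatives up to
  order \<open>k\<close> exist and are continuous.\<close>

primrec Ck :: "nat \<Rightarrow> ('a::real_normed_vector \<Rightarrow> 'b::real_normed_vector) \<Rightarrow> bool" where
  "Ck 0 f \<longleftrightarrow> continuous_on UNIV f"
| "Ck (Suc k) f \<longleftrightarrow>
     (\<forall>x. f differentiable (at x)) \<and> (\<forall>v. Ck k (\<lambda>x. frechet_derivative f (at x) v))"

definition smooth :: "('a::real_normed_vector \<Rightarrow> 'b::real_normed_vector) \<Rightarrow> bool" where
  "smooth f \<longleftrightarrow> (\<forall>k. Ck k f)"


subsection \<open>Riemannian metrics on Euclidean space\<close>

text \<open>\<open>g x $ i $ j\<close> is the \<open>(i, j)\<close> coefficient of the metric at \<open>x\<close> in Cartesian coordinates.\<close>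

definition riemannian_metric :: "(real ^ 'n \<Rightarrow> real ^ 'n ^ 'n) \<Rightarrow> bool" where
  "riemannian_metric g \<longleftrightarrow>
     (\<forall>i j. smooth (\<lambda>x. g x $ i $ j)) \<and>
     (\<forall>x. transpose (g x) = g x) \<and>
     (\<forall>x v. v \<noteq> 0 \<longrightarrow> v \<bullet> (g x *v v) > 0)"

definition riem_speed :: "(real ^ 'n \<Rightarrow> real ^ 'n ^ 'n) \<Rightarrow> (real \<Rightarrow> real ^ 'n) \<Rightarrow> real \<Rightarrow> real" where
  "riem_speed g \<gamma> t =
     sqrt (vector_derivative \<gamma> (at t) \<bullet> (g (\<gamma> t) *v vector_derivative \<gamma> (at t)))"

text \<open>Infimum of lengths of piecewise \<open>C\<^sup>1\<close> curves. A \<^const>\<open>valid_path\<close> may have an unbounded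
  derivative near its finitely many exceptional points, so the length is required to exist
  (\<^const>\<open>integral\<close> would return \<open>0\<close> for a curve of infinite length).\<close>

definition riem_dist :: "(real ^ 'n \<Rightarrow> real ^ 'n ^ 'n) \<Rightarrow> real ^ 'n \<Rightarrow> real ^ 'n \<Rightarrow> real" where
  "riem_dist g x y =
     Inf {L. \<exists>\<gamma>. valid_path \<gamma> \<and> pathstart \<gamma> = x \<and> pathfinish \<gamma> = y \<and>
                  (riem_speed g \<gamma> has_integral L) {0..1}}"

definition riem_ball :: "(real ^ 'n \<Rightarrow> real ^ 'n ^ 'n) \<Rightarrow> real ^ 'n \<Rightarrow> real \<Rightarrow> (real ^ 'n) set" where
  "riem_ball g p R = {x. riem_dist g p x < R}"

definition riem_vol :: "(real ^ 'n \<Rightarrow> real ^ 'n ^ 'n) \<Rightarrow> (real ^ 'n) set \<Rightarrow> ennreal" where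
  "riem_vol g A = (\<integral>\<^sup>+x\<in>A. ennreal (sqrt (det (g x))) \<partial>lborel)"

text \<open>The first conjunct holds for every Riemannian metric; it is stated because the library's
  \<open>mcomplete\<close> is only meaningful for a metric space.\<close>

definition riem_complete :: "(real ^ 'n \<Rightarrow> real ^ 'n ^ 'n) \<Rightarrow> bool" where
  "riem_complete g \<longleftrightarrow>
     Metric_space UNIV (riem_dist g) \<and> Metric_space.mcomplete UNIV (riem_dist g)"


subsection \<open>Rotationally symmetric metrics on the plane\<close>

definition polar :: "real \<Rightarrow> real \<Rightarrow> real ^ 2" where
  "polar r \<theta> = vector [r * cos \<theta>, r * sin \<theta>]"

text \<open>The coordinate vector fields \<open>\<partial>\<^sub>r\<close> and \<open>\<partial>\<^sub>\<theta>\<close> at the point \<open>polar r \<theta>\<close>.\<close>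

definition polar_dr :: "real \<Rightarrow> real \<Rightarrow> real ^ 2" where
  "polar_dr r \<theta> = vector [cos \<theta>, sin \<theta>]"

definition polar_dtheta :: "real \<Rightarrow> real \<Rightarrow> real ^ 2" where
  "polar_dtheta r \<theta> = vector [- r * sin \<theta>, r * cos \<theta>]"

text \<open>\<open>g = dr\<^sup>2 + \<phi>(r)\<^sup>2 d\<theta>\<^sup>2\<close> away from the origin. Only the values of \<open>\<phi>\<close> on \<open>(0, \<infinity>)\<close>
  matter. For a smooth \<open>g\<close> this makes \<open>\<phi>\<close> smooth there, and the value of \<open>g\<close> and the behaviour
  of \<open>\<phi>\<close> at the origin are determined by the smoothness of \<open>g\<close>.\<close>

definition rotationally_symmetric :: "(real ^ 2 \<Rightarrow> real ^ 2 ^ 2) \<Rightarrow> (real \<Rightarrow> real) \<Rightarrow> bool" where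
  "rotationally_symmetric g \<phi> \<longleftrightarrow>
     (\<forall>r>0. \<phi> r > 0 \<and>
        (\<forall>\<theta>. polar_dr r \<theta> \<bullet> (g (polar r \<theta>) *v polar_dr r \<theta>) = 1 \<and>
             polar_dr r \<theta> \<bullet> (g (polar r \<theta>) *v polar_dtheta r \<theta>) = 0 \<and>
             polar_dtheta r \<theta> \<bullet> (g (polar r \<theta>) *v polar_dtheta r \<theta>) = (\<phi> r)\<^sup>2))"

definition laplacian :: "(real \<Rightarrow> real) \<Rightarrow> (real ^ 2 \<Rightarrow> real) \<Rightarrow> real \<Rightarrow> real \<Rightarrow> real" where
  "laplacian \<phi> u r \<theta> =
     (deriv ^^ 2) (\<lambda>s. u (polar s \<theta>)) r
     + deriv \<phi> r / \<phi> r * deriv (\<lambda>s. u (polar s \<theta>)) r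
     + 1 / (\<phi> r)\<^sup>2 * (deriv ^^ 2) (\<lambda>t. u (polar r t)) \<theta>"

text \<open>Since \<open>u\<close> is \<open>C\<^sup>2\<close> on the whole plane, the equation extends to the origin by continuity.\<close>

definition harmonic :: "(real \<Rightarrow> real) \<Rightarrow> (real ^ 2 \<Rightarrow> real) \<Rightarrow> bool" where
  "harmonic \<phi> u \<longleftrightarrow> Ck 2 u \<and> (\<forall>r>0. \<forall>\<theta>. laplacian \<phi> u r \<theta> = 0)"

definition harmonic_growth ::
    "(real ^ 2 \<Rightarrow> real ^ 2 ^ 2) \<Rightarrow> (real \<Rightarrow> real) \<Rightarrow> nat \<Rightarrow> (real ^ 2 \<Rightarrow> real) set" where
  "harmonic_growth g \<phi> d =
     {u. harmonic \<phi> u \<and> bdd_above (range (\<lambda>x. \<bar>u x\<bar> / (1 + riem_dist g 0 x) ^ d))}"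

text \<open>Finite-dimensionality of a vector space of real functions with pointwise operations:
  existence of a finite spanning set.\<close>

definition finite_dim :: "('a \<Rightarrow> real) set \<Rightarrow> bool" where
  "finite_dim V \<longleftrightarrow>
     (\<exists>B. finite B \<and> B \<subseteq> V \<and> (\<forall>u\<in>V. \<exists>c. \<forall>x. u x = (\<Sum>b\<in>B. c b * b x)))"

end

theory Submission
  imports Defs
begin

text \<open>The metric is a cusp: \<open>\<phi>\<close> decays like \<open>exp(-r\<^sup>2 / 2)\<close>. Doubling fails because the ball of radius
  \<open>(N + 1) / 2\<close> about a point at distance \<open>N\<close> from the origin lies far out in the cusp and has tiny
  volume, whereas the ball of twice that radius contains the unit disc.

  Let \<open>u\<close> be harmonic of polynomial growth and \<open>E(r) = \<integral> u(r, \<theta>)\<^sup>2 d\<theta>\<close>. The flux \<open>F = \<phi> E'\<close> vanishes at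
  the origin and satisfies \<open>F' = 2 \<integral> (\<phi> u\<^sub>r\<^sup>2 + u\<^sub>\<theta>\<^sup>2 / \<phi>) d\<theta> \<ge> 0\<close>. If \<open>F\<close> were positive somewhere, then
  \<open>E' \<ge> c / \<phi>\<close> from there on and \<open>E\<close> would grow exponentially. So \<open>F = 0\<close>, hence \<open>u\<^sub>r = 0\<close> and \<open>u\<close> is
  constant. Both Liouville properties follow, with every \<open>H\<^sub>d\<close> equal to the constants.\<close>

subsection \<open>Closure properties of \<open>C\<^sup>k\<close> functions\<close>

lemma Ck_Suc_imp_Ck: "Ck (Suc k) f \<Longrightarrow> Ck k f"
proof (induction k arbitrary: f)
  case 0
  then show ?case
    by (auto simp: continuous_on_eq_continuous_at intro: differentiable_imp_continuous_within)
next
  case (Suc k)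
  then show ?case by (metis Ck.simps(2))
qed

text \<open>Lets an explicit derivative formula stand in for \<open>frechet_derivative\<close>, so
  that the closure properties below reduce to the usual rules of differentiation.\<close>

lemma Ck_SucI:
  assumes "\<And>x. (f has_derivative f' x) (at x)" and "\<And>v. Ck k (\<lambda>x. f' x v)"
  shows "Ck (Suc k) f"
proof -
  have "frechet_derivative f (at x) = f' x" for x
    using assms(1) frechet_derivative_at by metis
  then show ?thesis
    using assms by (auto simp: differentiable_def)
qed

lemma Ck_SucD:
  assumes "Ck (Suc k) f"
  shows "(f has_derivative frechet_derivative f (at x)) (at x)"
    and "Ck k (\<lambda>x. frechet_derivative f (at x) v)"
  using assms by (auto simp: frechet_derivative_works)

lemma Ck_const: "Ck k (\<lambda>x. c)"
proof (induction k arbitrary: c)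
  case (Suc k)
  show ?case by (rule Ck_SucI[where f' = "\<lambda>x v. 0"]) (auto intro: Suc)
qed simp

lemma Ck_linear:
  assumes "bounded_linear f"
  shows "Ck k f"
proof (cases k)
  case 0
  then show ?thesis using assms linear_continuous_on by auto
next
  case (Suc k')
  then show ?thesis
    using Ck_SucI[OF bounded_linear_imp_has_derivative[OF assms] Ck_const] by simp
qed

lemma Ck_add: "Ck k f \<Longrightarrow> Ck k g \<Longrightarrow> Ck k (\<lambda>x. f x + g x)"
proof (induction k arbitrary: f g)
  case 0
  then show ?case by (simp add: continuous_on_add)
next
  case (Suc k)
  show ?case
    by (rule Ck_SucI, rule has_derivative_add)
       (rule Ck_SucD[OF Suc.prems(1)] Ck_SucD[OF Suc.prems(2)] Suc.IH)+
qed

lemma Ck_mult: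
  fixes f g :: "'a::real_normed_vector \<Rightarrow> 'b::real_normed_algebra"
  shows "Ck k f \<Longrightarrow> Ck k g \<Longrightarrow> Ck k (\<lambda>x. f x * g x)"
proof (induction k arbitrary: f g)
  case 0
  then show ?case by (simp add: continuous_on_mult)
next
  case (Suc k)
  show ?case
    by (rule Ck_SucI, rule has_derivative_mult)
       (rule Ck_SucD[OF Suc.prems(1)] Ck_SucD[OF Suc.prems(2)] Suc.IH Ck_add
          Ck_Suc_imp_Ck[OF Suc.prems(1)] Ck_Suc_imp_Ck[OF Suc.prems(2)])+
qed

lemma Ck_minus:
  fixes f :: "'a::real_normed_vector \<Rightarrow> 'b::real_normed_algebra_1"
  assumes "Ck k f" shows "Ck k (\<lambda>x. - f x)"
  using Ck_mult[OF Ck_const[of k "-1"] assms] by simp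

text \<open>The function reappears as a factor of its own derivative, so the induction runs on the
  order \<open>k\<close> alone with \<open>f\<close> fixed. The same holds for the reciprocal
  below.\<close>

lemma Ck_exp:
  fixes f :: "'a::real_normed_vector \<Rightarrow> real"
  shows "Ck k f \<Longrightarrow> Ck k (\<lambda>x. exp (f x))"
proof (induction k)
  case 0
  then show ?case by (simp add: continuous_on_exp)
next
  case (Suc k)
  have "Ck k (\<lambda>x. exp (f x))"
    by (rule Suc.IH) (rule Ck_Suc_imp_Ck[OF Suc.prems])
  then show ?case
    by (intro Ck_SucI[OF has_derivative_exp[OF Ck_SucD(1)[OF Suc.prems]]] Ck_mult
        Ck_SucD(2)[OF Suc.prems])
qed

lemma Ck_inverse:
  fixes f :: "'a::real_normed_vector \<Rightarrow> real"
  assumes nz: "\<And>x. f x \<noteq> 0"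
  shows "Ck k f \<Longrightarrow> Ck k (\<lambda>x. inverse (f x))"
proof (induction k)
  case 0
  then show ?case using nz by (simp add: continuous_on_inverse)
next
  case (Suc k)
  have "Ck k (\<lambda>x. inverse (f x))"
    by (rule Suc.IH) (rule Ck_Suc_imp_Ck[OF Suc.prems])
  then show ?case
    by (intro Ck_SucI[OF Deriv.has_derivative_inverse[OF nz Ck_SucD(1)[OF Suc.prems]]] Ck_mult Ck_minus
        Ck_SucD(2)[OF Suc.prems])
qed

subsection \<open>Riemannian distance\<close>

text \<open>A relation rather than a length function, so that finiteness of the length is part of
  it.\<close>

definition has_riem_length :: "(real ^ 'n \<Rightarrow> real ^ 'n ^ 'n) \<Rightarrow> (real \<Rightarrow> real ^ 'n) \<Rightarrow> real \<Rightarrow> bool" where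
  "has_riem_length g \<gamma> L \<longleftrightarrow> valid_path \<gamma> \<and> (riem_speed g \<gamma> has_integral L) {0..1}"

lemma riem_dist_eq_Inf:
  "riem_dist g x y = Inf {L. \<exists>\<gamma>. has_riem_length g \<gamma> L \<and> pathstart \<gamma> = x \<and> pathfinish \<gamma> = y}"
  unfolding riem_dist_def has_riem_length_def by (metis (no_types, lifting))

lemma riem_speed_nonneg:
  assumes "riemannian_metric g"
  shows "riem_speed g \<gamma> t \<ge> 0"
proof -
  have "v \<bullet> (g x *v v) \<ge> 0" for x v
    using assms unfolding riemannian_metric_def by (cases "v = 0") (auto intro: less_imp_le)
  then show ?thesis by (simp add: riem_speed_def)
qed

lemma has_riem_length_nonneg:
  assumes "riemannian_metric g" "has_riem_length g \<gamma> L"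
  shows "L \<ge> 0"
  using assms riem_speed_nonneg has_integral_nonneg unfolding has_riem_length_def by blast

lemma riem_dist_le_length:
  assumes g: "riemannian_metric g" and L: "has_riem_length g \<gamma> L"
  shows "riem_dist g (pathstart \<gamma>) (pathfinish \<gamma>) \<le> L"
  unfolding riem_dist_eq_Inf
  using L has_riem_length_nonneg[OF g] by (intro cInf_lower bdd_belowI[where m = 0]) auto

text \<open>The metric coefficients are continuous, hence so is the speed along a segment. Segments
  thus have finite length, and the infimum defining the distance is over a nonempty set.\<close>

lemma has_riem_length_linepath:
  assumes g: "riemannian_metric g"
  shows "has_riem_length g (linepath x y)
    (integral {0..1} (\<lambda>t. sqrt ((y - x) \<bullet> (g (linepath x y t) *v (y - x)))))"
proof -
  have "continuous_on UNIV (\<lambda>x. g x $ i $ j)" for i j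
    using g unfolding riemannian_metric_def smooth_def by (metis Ck.simps(1))
  then have "continuous_on UNIV (\<lambda>x. \<chi> i j. g x $ i $ j)"
    by (intro continuous_on_vec_lambda)
  then have "continuous_on UNIV g" by (simp add: vec_lambda_eta)
  then have c: "continuous_on {0..1} (\<lambda>t. g (linepath x y t))"
    by (rule continuous_on_compose2) (auto intro: continuous_on_linepath)
  have "continuous_on {0..1} (\<lambda>t. g (linepath x y t) *v (y - x))"
    unfolding matrix_vector_mult_def
    by (intro continuous_intros continuous_on_vec_lambda continuous_on_component c)
  then have "continuous_on {0..1} (\<lambda>t. sqrt ((y - x) \<bullet> (g (linepath x y t) *v (y - x))))"
    by (intro continuous_intros)
  then have "((\<lambda>t. sqrt ((y - x) \<bullet> (g (linepath x y t) *v (y - x)))) has_integral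
      integral {0..1} (\<lambda>t. sqrt ((y - x) \<bullet> (g (linepath x y t) *v (y - x))))) {0..1}"
    using integrable_continuous_real by blast
  then show ?thesis
    by (simp add: has_riem_length_def riem_speed_def[abs_def])
qed

lemma ex_has_riem_length:
  assumes "riemannian_metric g"
  obtains \<gamma> L where "has_riem_length g \<gamma> L" "pathstart \<gamma> = x" "pathfinish \<gamma> = y"
  using has_riem_length_linepath[OF assms, of x y] by (metis pathstart_linepath pathfinish_linepath)

lemma riem_dist_greatest:
  assumes g: "riemannian_metric g"
    and "\<And>\<gamma> L. has_riem_length g \<gamma> L \<Longrightarrow> pathstart \<gamma> = x \<Longrightarrow> pathfinish \<gamma> = y \<Longrightarrow> c \<le> L"
  shows "c \<le> riem_dist g x y"
proof -
  obtain \<gamma> L where "has_riem_length g \<gamma> L" "pathstart \<gamma> = x" "pathfinish \<gamma> = y"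
    by (rule ex_has_riem_length[OF g])
  then show ?thesis
    unfolding riem_dist_eq_Inf by (intro cInf_greatest) (use assms(2) in auto)
qed

lemma riem_dist_nonneg: "riemannian_metric g \<Longrightarrow> riem_dist g x y \<ge> 0"
  by (rule riem_dist_greatest) (auto intro: has_riem_length_nonneg)

lemma riem_dist_approx:
  assumes g: "riemannian_metric g" and e: "e > 0"
  obtains \<gamma> L where "has_riem_length g \<gamma> L" "pathstart \<gamma> = x" "pathfinish \<gamma> = y"
    "L < riem_dist g x y + e"
proof -
  have "\<exists>\<gamma> L. has_riem_length g \<gamma> L \<and> pathstart \<gamma> = x \<and> pathfinish \<gamma> = y \<and> L < riem_dist g x y + e"
  proof (rule ccontr)
    assume "\<not> ?thesis"
    then have "riem_dist g x y + e \<le> riem_dist g x y"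
      by (intro riem_dist_greatest[OF g]) (metis not_le)
    with e show False by simp
  qed
  then show thesis using that by blast
qed

text \<open>The straight segment is a competitor, and its length does not exceed its Euclidean
  length.\<close>

lemma riem_dist_le_norm:
  assumes g: "riemannian_metric g" and le: "\<And>x v. v \<bullet> (g x *v v) \<le> v \<bullet> v"
  shows "riem_dist g x y \<le> norm (y - x)"
proof -
  let ?f = "\<lambda>t. sqrt ((y - x) \<bullet> (g (linepath x y t) *v (y - x)))"
  have L: "has_riem_length g (linepath x y) (integral {0..1} ?f)"
    by (rule has_riem_length_linepath[OF g])
  then have i: "(?f has_integral integral {0..1} ?f) {0..1}"
    by (simp add: has_riem_length_def riem_speed_def[abs_def])
  have c: "((\<lambda>t. norm (y - x)) has_integral norm (y - x)) {0..1::real}"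
    using has_integral_const_real[of "norm (y - x)" 0 1] by simp
  have "integral {0..1} ?f \<le> norm (y - x)"
    by (rule has_integral_le[OF i c]) (simp add: le norm_eq_sqrt_inner)
  with riem_dist_le_length[OF g L] show ?thesis by simp
qed

lemma valid_path_vector_derivative:
  assumes "valid_path \<gamma>"
  obtains S where "finite S"
    "\<And>t. t \<in> {0..1} - S \<Longrightarrow> (\<gamma> has_vector_derivative vector_derivative \<gamma> (at t)) (at t)"
  using assms unfolding valid_path_def piecewise_C1_differentiable_on_def C1_differentiable_on_eq
  by (metis vector_derivative_works)

text \<open>Integrating the derivative of \<open>F\<close> along a curve bounds the change of
  \<open>F\<close> by \<open>K\<close> times the length. Lower bounds for the distance are obtained
  from this by a choice of test function \<open>F\<close>. The fundamental theorem is used in the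
  form that tolerates the finitely many corners of the curve.\<close>

lemma riem_dist_ge_Lipschitz:
  fixes F :: "real ^ 'n \<Rightarrow> real"
  assumes g: "riemannian_metric g"
    and F: "\<And>x. (F has_derivative F' x) (at x)"
    and K: "\<And>x v. \<bar>F' x v\<bar> \<le> K * sqrt (v \<bullet> (g x *v v))" "K > 0"
  shows "\<bar>F y - F x\<bar> \<le> K * riem_dist g x y"
proof -
  have "\<bar>F y - F x\<bar> / K \<le> riem_dist g x y"
  proof (rule riem_dist_greatest[OF g])
    fix \<gamma> L
    assume L: "has_riem_length g \<gamma> L" and st: "pathstart \<gamma> = x" "pathfinish \<gamma> = y"
    then have vp: "valid_path \<gamma>" and i: "(riem_speed g \<gamma> has_integral L) {0..1}"
      by (auto simp: has_riem_length_def)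
    obtain S where S: "finite S"
      "\<And>t. t \<in> {0..1} - S \<Longrightarrow> (\<gamma> has_vector_derivative vector_derivative \<gamma> (at t)) (at t)"
      using valid_path_vector_derivative[OF vp] by blast
    let ?D = "\<lambda>t. F' (\<gamma> t) (vector_derivative \<gamma> (at t))"
    have "(?D has_integral (F \<circ> \<gamma>) 1 - (F \<circ> \<gamma>) 0) {0..1}"
    proof (rule fundamental_theorem_of_calculus_interior_strong[OF S(1)])
      fix t assume t: "t \<in> {0<..<1} - S"
      then have "(\<gamma> has_derivative (\<lambda>h. h *\<^sub>R vector_derivative \<gamma> (at t))) (at t)"
        using S(2)[of t] by (simp add: has_vector_derivative_def)
      from diff_chain_at[OF this F] show "((F \<circ> \<gamma>) has_vector_derivative ?D t) (at t)"
        using has_derivative_linear[OF F, of "\<gamma> t"]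
        by (simp add: has_vector_derivative_def o_def linear_scale)
    next
      have "continuous_on UNIV F"
        using F by (auto intro!: continuous_at_imp_continuous_on has_derivative_continuous)
      then show "continuous_on {0..1} (F \<circ> \<gamma>)"
        using vp valid_path_imp_path[of \<gamma>] unfolding path_def
        by (metis continuous_on_compose continuous_on_subset top_greatest)
    qed simp
    then have D: "(?D has_integral F y - F x) {0..1}"
      using st by (simp add: pathstart_def pathfinish_def)
    have KL: "((\<lambda>t. K * riem_speed g \<gamma> t) has_integral K * L) {0..1}"
      using i by (rule has_integral_mult_right)
    have b: "\<bar>?D t\<bar> \<le> K * riem_speed g \<gamma> t" for t
      using K(1) by (simp add: riem_speed_def)
    have "F y - F x \<le> K * L"
      by (rule has_integral_le[OF D KL]) (use b abs_le_D1 in blast)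
    moreover have "- (F y - F x) \<le> K * L"
      by (rule has_integral_le[OF has_integral_neg[OF D] KL]) (use b abs_le_D2 in blast)
    ultimately show "\<bar>F y - F x\<bar> / K \<le> L"
      using K(2) by (simp add: divide_le_eq mult.commute)
  qed
  then show ?thesis using K(2) by (simp add: divide_le_eq mult.commute)
qed

section \<open>Symmetry of the distance and the triangle inequality\<close>

lemma has_riem_length_reversepath:
  assumes "has_riem_length g \<gamma> L"
  shows "has_riem_length g (reversepath \<gamma>) L"
proof -
  have vp: "valid_path \<gamma>" and i: "(riem_speed g \<gamma> has_integral L) {0..1}"
    using assms by (auto simp: has_riem_length_def)
  obtain S where S: "finite S"
    "\<And>t. t \<in> {0..1} - S \<Longrightarrow> (\<gamma> has_vector_derivative vector_derivative \<gamma> (at t)) (at t)"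
    using valid_path_vector_derivative[OF vp] by blast
  \<comment> \<open>Reversal reflects the parameter and changes the sign of the velocity; the
    quadratic form under the root does not see the sign.\<close>
  have d: "vector_derivative (reversepath \<gamma>) (at t) = - vector_derivative \<gamma> (at (1 - t))"
    if "t \<in> {0..1} - (\<lambda>t. 1 - t) ` S" for t
  proof (rule vector_derivative_at)
    have "1 - t \<in> {0..1} - S" using that by force
    then have "(\<gamma> has_vector_derivative vector_derivative \<gamma> (at (1 - t))) (at (1 - t))"
      by (rule S(2))
    moreover have "((\<lambda>t. 1 - t) has_vector_derivative (-1)) (at t)"
      by (auto intro!: derivative_eq_intros)
    ultimately have "(\<gamma> \<circ> (\<lambda>t. 1 - t) has_vector_derivative -1 *\<^sub>R vector_derivative \<gamma> (at (1 - t))) (at t)"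
      by (intro vector_diff_chain_at)
    then show "(reversepath \<gamma> has_vector_derivative - vector_derivative \<gamma> (at (1 - t))) (at t)"
      by (simp add: reversepath_def o_def)
  qed
  have neg: "A *v (- v) = - (A *v v)" for A :: "real^'a^'a" and v
    by (rule linear_neg) simp
  have "((\<lambda>t. riem_speed g \<gamma> (1 - t)) has_integral L) {0..1}"
    using has_integral_affinity01[OF i, of "-1" 1] by simp
  then have "(riem_speed g (reversepath \<gamma>) has_integral L) {0..1}"
    by (rule has_integral_spike_finite[rotated 2, of _ _ _ "(\<lambda>t. 1 - t) ` S"])
       (use S(1) d in \<open>auto simp: riem_speed_def reversepath_def neg\<close>)
  with vp show ?thesis by (simp add: has_riem_length_def)
qed

lemma riem_dist_commute:
  assumes g: "riemannian_metric g"
  shows "riem_dist g x y = riem_dist g y x"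
proof -
  have "riem_dist g x y \<le> riem_dist g y x" for x y
    by (rule riem_dist_greatest[OF g])
       (use riem_dist_le_length[OF g has_riem_length_reversepath] in fastforce)
  then show ?thesis by (meson antisym)
qed

text \<open>Each curve is run through at double speed on half of the interval, which leaves its
  length unchanged.\<close>

lemma has_riem_length_join:
  assumes "has_riem_length g \<gamma>1 L1" "has_riem_length g \<gamma>2 L2" "pathfinish \<gamma>1 = pathstart \<gamma>2"
  shows "has_riem_length g (\<gamma>1 +++ \<gamma>2) (L1 + L2)"
proof -
  have vp: "valid_path \<gamma>1" "valid_path \<gamma>2"
    and i: "(riem_speed g \<gamma>1 has_integral L1) {0..1}" "(riem_speed g \<gamma>2 has_integral L2) {0..1}"
    using assms by (auto simp: has_riem_length_def)
  obtain S1 where S1: "finite S1"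
    "\<And>t. t \<in> {0..1} - S1 \<Longrightarrow> (\<gamma>1 has_vector_derivative vector_derivative \<gamma>1 (at t)) (at t)"
    using valid_path_vector_derivative[OF vp(1)] by blast
  obtain S2 where S2: "finite S2"
    "\<And>t. t \<in> {0..1} - S2 \<Longrightarrow> (\<gamma>2 has_vector_derivative vector_derivative \<gamma>2 (at t)) (at t)"
    using valid_path_vector_derivative[OF vp(2)] by blast
  have sq: "sqrt (2 *\<^sub>R v \<bullet> (A *v 2 *\<^sub>R v)) = 2 * sqrt (v \<bullet> (A *v v))" for v and A :: "real^'a^'a"
  proof -
    have "2 *\<^sub>R v \<bullet> (A *v 2 *\<^sub>R v) = 2\<^sup>2 * (v \<bullet> (A *v v))"
      by (simp add: scaleR_matrix_vector_assoc[symmetric] matrix_vector_mult_scaleR)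
    then show ?thesis by (simp only: real_sqrt_mult real_sqrt_pow2_iff) simp
  qed
  \<comment> \<open>Besides the rescaled corners, the midpoint is excluded: away from it the joined
    curve agrees locally with one of the two pieces, so its derivative there is that of the piece. A
    finite set does not affect the integrals.\<close>
  let ?T = "insert (1/2) ((\<lambda>t. t / 2) ` S1 \<union> (\<lambda>t. (t + 1) / 2) ` S2)"
  have fin: "finite ?T" using S1(1) S2(1) by simp
  have s1: "riem_speed g (\<gamma>1 +++ \<gamma>2) t = 2 * riem_speed g \<gamma>1 (2 * t)"
    if t: "t \<in> {0..1/2} - ?T" for t
  proof -
    have "t \<notin> (\<lambda>t. t / 2) ` S1" using t by blast
    then have "2 * t \<notin> S1" using image_eqI[of t "\<lambda>t. t / 2" "2 * t" S1] by auto
    then have tS: "2 * t \<in> {0..1} - S1" using t by simp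
    have th: "t < 1/2" using t by auto
    have "((\<lambda>t. 2 * t) has_vector_derivative 2) (at t)"
      by (auto intro!: derivative_eq_intros)
    from vector_diff_chain_at[OF this S1(2)[OF tS]]
    have "((\<lambda>t. \<gamma>1 (2 * t)) has_vector_derivative 2 *\<^sub>R vector_derivative \<gamma>1 (at (2 * t))) (at t)"
      by (simp add: o_def)
    then have "((\<gamma>1 +++ \<gamma>2) has_vector_derivative 2 *\<^sub>R vector_derivative \<gamma>1 (at (2 * t))) (at t)"
      by (rule has_vector_derivative_transform_within[where d = "1/2 - t"])
         (use th in \<open>auto simp: joinpaths_def dist_real_def\<close>)
    then have "vector_derivative (\<gamma>1 +++ \<gamma>2) (at t) = 2 *\<^sub>R vector_derivative \<gamma>1 (at (2 * t))"
      by (rule vector_derivative_at)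
    moreover have "(\<gamma>1 +++ \<gamma>2) t = \<gamma>1 (2 * t)" using th by (simp add: joinpaths_def)
    ultimately show ?thesis by (simp only: riem_speed_def sq)
  qed
  have s2: "riem_speed g (\<gamma>1 +++ \<gamma>2) t = 2 * riem_speed g \<gamma>2 (2 * t - 1)"
    if t: "t \<in> {1/2..1} - ?T" for t
  proof -
    have "t \<notin> (\<lambda>t. (t + 1) / 2) ` S2" using t by blast
    then have "2 * t - 1 \<notin> S2" using image_eqI[of t "\<lambda>t. (t + 1) / 2" "2 * t - 1" S2] by auto
    then have tS: "2 * t - 1 \<in> {0..1} - S2" using t by simp
    have th: "t > 1/2" using t by auto
    have "((\<lambda>t. 2 * t - 1) has_vector_derivative 2) (at t)"
      by (auto intro!: derivative_eq_intros)
    from vector_diff_chain_at[OF this S2(2)[OF tS]]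
    have "((\<lambda>t. \<gamma>2 (2 * t - 1)) has_vector_derivative 2 *\<^sub>R vector_derivative \<gamma>2 (at (2 * t - 1))) (at t)"
      by (simp add: o_def)
    then have "((\<gamma>1 +++ \<gamma>2) has_vector_derivative 2 *\<^sub>R vector_derivative \<gamma>2 (at (2 * t - 1))) (at t)"
      by (rule has_vector_derivative_transform_within[where d = "t - 1/2"])
         (use th in \<open>auto simp: joinpaths_def dist_real_def\<close>)
    then have "vector_derivative (\<gamma>1 +++ \<gamma>2) (at t) = 2 *\<^sub>R vector_derivative \<gamma>2 (at (2 * t - 1))"
      by (rule vector_derivative_at)
    moreover have "(\<gamma>1 +++ \<gamma>2) t = \<gamma>2 (2 * t - 1)" using th by (simp add: joinpaths_def)
    ultimately show ?thesis by (simp only: riem_speed_def sq)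
  qed
  have "((\<lambda>t. 2 * riem_speed g \<gamma>1 (2 * t)) has_integral L1) {0..1/2}"
    using has_integral_affinity01[OF i(1), where m = 2 and c = 0, THEN has_integral_mult_right[where c = 2]]
    by (simp add: image_affinity_atLeastAtMost_div_diff)
  then have I1: "(riem_speed g (\<gamma>1 +++ \<gamma>2) has_integral L1) {0..1/2}"
    by (rule has_integral_spike_finite[OF fin, rotated]) (rule s1)
  have "((\<lambda>t. 2 * riem_speed g \<gamma>2 (2 * t - 1)) has_integral L2) {1/2..1}"
    using has_integral_affinity01[OF i(2), where m = 2 and c = "-1", THEN has_integral_mult_right[where c = 2]]
    by (simp only: image_affinity_atLeastAtMost_div_diff) simp
  then have I2: "(riem_speed g (\<gamma>1 +++ \<gamma>2) has_integral L2) {1/2..1}"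
    by (rule has_integral_spike_finite[OF fin, rotated]) (rule s2)
  have "(riem_speed g (\<gamma>1 +++ \<gamma>2) has_integral L1 + L2) {0..1}"
    by (rule has_integral_combine[OF _ _ I1 I2]) auto
  with vp assms(3) show ?thesis
    by (simp add: has_riem_length_def valid_path_join)
qed

lemma riem_dist_triangle:
  assumes g: "riemannian_metric g"
  shows "riem_dist g x z \<le> riem_dist g x y + riem_dist g y z"
proof (rule field_le_epsilon)
  fix e :: real assume "e > 0"
  then have e: "e / 2 > 0" by simp
  obtain \<gamma>1 L1 where 1: "has_riem_length g \<gamma>1 L1" "pathstart \<gamma>1 = x" "pathfinish \<gamma>1 = y"
    "L1 < riem_dist g x y + e / 2"
    by (rule riem_dist_approx[OF g e])
  obtain \<gamma>2 L2 where 2: "has_riem_length g \<gamma>2 L2" "pathstart \<gamma>2 = y" "pathfinish \<gamma>2 = z"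
    "L2 < riem_dist g y z + e / 2"
    by (rule riem_dist_approx[OF g e])
  have "riem_dist g x z \<le> L1 + L2"
    using riem_dist_le_length[OF g has_riem_length_join[OF 1(1) 2(1)]] 1 2 by simp
  then show "riem_dist g x z \<le> riem_dist g x y + riem_dist g y z + e"
    using 1(4) 2(4) by simp
qed

subsection \<open>The cusp metric\<close>

text \<open>The quarter turn. As a vector field it is the angular field, linear and therefore smooth
  across the origin.\<close>

definition perp :: "real ^ 2 \<Rightarrow> real ^ 2" where
  "perp x = vector [- (x $ 2), x $ 1]"

text \<open>The profile \<open>\<phi>\<^sup>2 = r\<^sup>2 / (1 + r\<^sup>2 exp(r\<^sup>2))\<close> is chosen so that \<open>\<phi>\<close> decays superexponentially while
  \<open>1 - \<phi>\<^sup>2 / r\<^sup>2 = r\<^sup>2 / (r\<^sup>2 + exp(-r\<^sup>2))\<close>. The metric is the identity minus this factor times the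
  orthogonal projection to the angular direction, and the numerator \<open>r\<^sup>2\<close> cancels the singularity of
  the projection at the origin.\<close>

definition cusp_metric :: "real ^ 2 \<Rightarrow> real ^ 2 ^ 2" where
  "cusp_metric x =
     (\<chi> i j. (if i = j then 1 else 0) - perp x $ i * perp x $ j / (x \<bullet> x + exp (- (x \<bullet> x))))"

definition cusp_radius :: "real \<Rightarrow> real" where
  "cusp_radius r = r / sqrt (1 + r\<^sup>2 * exp (r\<^sup>2))"

lemma inner_plus_exp_pos: "x \<bullet> x + exp (- (x \<bullet> x)) > (0::real)"
  by (simp add: add_nonneg_pos)

lemma cusp_metric_inner:
  "v \<bullet> (cusp_metric x *v w) = v \<bullet> w - (perp x \<bullet> v) * (perp x \<bullet> w) / (x \<bullet> x + exp (- (x \<bullet> x)))"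
  unfolding cusp_metric_def
  by (simp add: inner_vec_def[of v] inner_vec_def[of "perp x"] matrix_vector_mult_def sum_2 add_divide_distrib algebra_simps)

text \<open>Pythagoras for \<open>v\<close> in the orthogonal directions \<open>x\<close> and
  \<open>perp x\<close>, both of norm |x|.\<close>

lemma perp_inner_squared: "(perp x \<bullet> v)\<^sup>2 = (x \<bullet> x) * (v \<bullet> v) - (x \<bullet> v)\<^sup>2"
  by (simp add: perp_def inner_vec_def sum_2 power2_eq_square algebra_simps)

lemma cusp_metric_quadratic:
  "v \<bullet> (cusp_metric x *v v) = v \<bullet> v - (perp x \<bullet> v)\<^sup>2 / (x \<bullet> x + exp (- (x \<bullet> x)))"
  by (simp add: cusp_metric_inner power2_eq_square)

lemma cusp_metric_le: "v \<bullet> (cusp_metric x *v v) \<le> v \<bullet> v"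
  using inner_plus_exp_pos[of x] by (simp add: cusp_metric_quadratic)

text \<open>The factor on the right is the eigenvalue of the metric in the angular direction, which
  is the shrunken one.\<close>

lemma cusp_metric_ge:
  "v \<bullet> (cusp_metric x *v v) \<ge> (v \<bullet> v) * (exp (- (x \<bullet> x)) / (x \<bullet> x + exp (- (x \<bullet> x))))"
proof -
  let ?q = "x \<bullet> x + exp (- (x \<bullet> x))"
  have q: "?q > 0" by (rule inner_plus_exp_pos)
  have "(perp x \<bullet> v)\<^sup>2 / ?q \<le> (x \<bullet> x) * (v \<bullet> v) / ?q"
    using q by (intro divide_right_mono) (simp_all add: perp_inner_squared)
  moreover have "(v \<bullet> v) * (exp (- (x \<bullet> x)) / ?q) = v \<bullet> v - (x \<bullet> x) * (v \<bullet> v) / ?q"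
    using q by (simp add: field_simps)
  ultimately show ?thesis
    unfolding cusp_metric_quadratic by linarith
qed

text \<open>Away from the origin this says that the gradient of the radius has length at most 1:
  radial directions are not shrunk.\<close>

lemma cusp_metric_radial_ge: "(x \<bullet> v)\<^sup>2 \<le> (x \<bullet> x) * (v \<bullet> (cusp_metric x *v v))"
proof -
  let ?q = "x \<bullet> x + exp (- (x \<bullet> x))"
  have q: "?q > 0" by (rule inner_plus_exp_pos)
  have "(x \<bullet> x) * (perp x \<bullet> v)\<^sup>2 / ?q \<le> (perp x \<bullet> v)\<^sup>2"
    using q by (simp add: divide_le_eq algebra_simps)
  moreover have "(x \<bullet> x) * (v \<bullet> (cusp_metric x *v v)) =
      (x \<bullet> v)\<^sup>2 + (perp x \<bullet> v)\<^sup>2 - (x \<bullet> x) * (perp x \<bullet> v)\<^sup>2 / ?q"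
    by (simp add: cusp_metric_quadratic perp_inner_squared right_diff_distrib)
  ultimately show ?thesis by linarith
qed

text \<open>The coefficients are built from linear functions, an exponential and the reciprocal of a
  denominator that is positive even at the origin.\<close>

lemma riemannian_cusp_metric: "riemannian_metric cusp_metric"
  unfolding riemannian_metric_def
proof (intro conjI allI impI)
  fix i j :: 2
  have comp: "Ck k (\<lambda>x. x $ l)" for k and l :: 2
    by (rule Ck_linear) (rule bounded_linear_vec_nth)
  have perp: "Ck k (\<lambda>x. perp x $ l)" for k l
  proof -
    consider "l = 1" | "l = 2" using exhaust_2 by blast
    then show ?thesis
      by cases (auto simp: perp_def intro: comp Ck_minus)
  qed
  have sq: "Ck k (\<lambda>x::real^2. x \<bullet> x)" for k
    by (simp add: inner_vec_def sum_2 Ck_add Ck_mult comp)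
  have "Ck k (\<lambda>x. cusp_metric x $ i $ j)" for k
    unfolding cusp_metric_def diff_conv_add_uminus divide_inverse vec_lambda_beta
    by (intro Ck_add Ck_minus Ck_const Ck_mult Ck_inverse Ck_exp perp sq
          less_imp_neq[OF inner_plus_exp_pos, symmetric])
  then show "smooth (\<lambda>x. cusp_metric x $ i $ j)"
    by (simp add: smooth_def)
next
  fix x show "transpose (cusp_metric x) = cusp_metric x"
    by (simp add: transpose_def cusp_metric_def vec_eq_iff)
next
  fix x v :: "real^2" assume "v \<noteq> 0"
  then have "0 < (v \<bullet> v) * (exp (- (x \<bullet> x)) / (x \<bullet> x + exp (- (x \<bullet> x))))"
    using inner_plus_exp_pos[of x] by simp
  also note cusp_metric_ge
  finally show "0 < v \<bullet> (cusp_metric x *v v)" .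
qed

section \<open>The cusp metric in polar coordinates\<close>

lemma cusp_radius_pos: "r > 0 \<Longrightarrow> cusp_radius r > 0"
  by (simp add: cusp_radius_def add_pos_nonneg)

text \<open>Brings the squared profile to the denominator that occurs in
  \<open>cusp_metric\<close>.\<close>

lemma cusp_radius_squared: "(cusp_radius r)\<^sup>2 = r\<^sup>2 * exp (- r\<^sup>2) / (r\<^sup>2 + exp (- r\<^sup>2))"
proof -
  have "(cusp_radius r)\<^sup>2 = r\<^sup>2 / (1 + r\<^sup>2 * exp (r\<^sup>2))"
    by (simp add: cusp_radius_def power_divide)
  also have "\<dots> = r\<^sup>2 * exp (- r\<^sup>2) / (r\<^sup>2 + exp (- r\<^sup>2))"
    by (simp add: exp_minus field_simps)
  finally show ?thesis .
qed

lemma rotationally_symmetric_cusp: "rotationally_symmetric cusp_metric cusp_radius"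
  unfolding rotationally_symmetric_def
proof (intro allI impI conjI)
  fix r \<theta> :: real assume r: "r > 0"
  show "cusp_radius r > 0" using r by (rule cusp_radius_pos)
  have t: "polar r \<theta> \<bullet> polar r \<theta> = r\<^sup>2"
    using sin_cos_squared_add[of \<theta>]
    by (simp add: polar_def inner_vec_def sum_2 power2_eq_square algebra_simps flip: distrib_left)
  have p: "perp (polar r \<theta>) = polar_dtheta r \<theta>"
    by (simp add: perp_def polar_def polar_dtheta_def)
  have rt: "polar_dtheta r \<theta> \<bullet> polar_dr r \<theta> = 0" "polar_dr r \<theta> \<bullet> polar_dtheta r \<theta> = 0"
    by (simp_all add: polar_dr_def polar_dtheta_def inner_vec_def sum_2)
  have rr: "polar_dr r \<theta> \<bullet> polar_dr r \<theta> = 1"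
    using sin_cos_squared_add[of \<theta>] by (simp add: polar_dr_def inner_vec_def sum_2 power2_eq_square)
  have tt: "polar_dtheta r \<theta> \<bullet> polar_dtheta r \<theta> = r\<^sup>2"
    using sin_cos_squared_add[of \<theta>]
    by (simp add: polar_dtheta_def inner_vec_def sum_2 power2_eq_square algebra_simps flip: distrib_left)
  show "polar_dr r \<theta> \<bullet> (cusp_metric (polar r \<theta>) *v polar_dr r \<theta>) = 1"
    by (simp add: cusp_metric_inner p rt rr)
  show "polar_dr r \<theta> \<bullet> (cusp_metric (polar r \<theta>) *v polar_dtheta r \<theta>) = 0"
    by (simp add: cusp_metric_inner p rt)
  have "r\<^sup>2 + exp (- r\<^sup>2) > 0" using r by (simp add: add_pos_pos)
  then show "polar_dtheta r \<theta> \<bullet> (cusp_metric (polar r \<theta>) *v polar_dtheta r \<theta>) = (cusp_radius r)\<^sup>2"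
    by (simp add: cusp_metric_inner p t tt cusp_radius_squared) (simp add: field_simps power2_eq_square power4_eq_xxxx)
qed

section \<open>Comparison of the cusp distance with Euclidean quantities\<close>

lemma cusp_dist_le_norm: "riem_dist cusp_metric x y \<le> norm (y - x)"
  by (rule riem_dist_le_norm[OF riemannian_cusp_metric cusp_metric_le])

text \<open>The cube of 1 + t/3 \<le> exp(t/3). It absorbs the polynomial factors in the angular
  estimate and in the volume bound.\<close>

lemma cube_le_exp: "t \<ge> 0 \<Longrightarrow> (1 + t / 3) ^ 3 \<le> exp (t::real)"
proof -
  assume t: "t \<ge> 0"
  have "(1 + t / 3) ^ 3 \<le> exp (t / 3) ^ 3"
    using t by (intro power_mono) auto
  also have "\<dots> = exp t" by (simp flip: exp_of_nat_mult)
  finally show ?thesis .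
qed

text \<open>The test function is sqrt(1 + |x|^2), a replacement for the norm that is differentiable
  at the origin; its gradient with respect to the metric has length at most 1.\<close>

lemma cusp_dist_ge_radial: "\<bar>sqrt (1 + y \<bullet> y) - sqrt (1 + x \<bullet> x)\<bar> \<le> riem_dist cusp_metric x y"
proof -
  have "\<bar>sqrt (1 + y \<bullet> y) - sqrt (1 + x \<bullet> x)\<bar> \<le> 1 * riem_dist cusp_metric x y"
  proof (rule riem_dist_ge_Lipschitz[OF riemannian_cusp_metric])
    fix x :: "real^2"
    have "1 + x \<bullet> x > 0" by (simp add: add_pos_nonneg)
    then show "((\<lambda>x. sqrt (1 + x \<bullet> x)) has_derivative (\<lambda>v. (x \<bullet> v) / sqrt (1 + x \<bullet> x))) (at x)"
      by (auto intro!: derivative_eq_intros simp: fun_eq_iff inner_commute field_simps)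
  next
    fix x v :: "real^2"
    let ?Q = "v \<bullet> (cusp_metric x *v v)"
    have Q: "?Q \<ge> 0"
      using riemannian_cusp_metric by (cases "v = 0") (auto simp: riemannian_metric_def less_imp_le)
    have "(x \<bullet> v)\<^sup>2 \<le> (1 + x \<bullet> x) * ?Q"
      using cusp_metric_radial_ge[of x v] Q by (simp add: algebra_simps)
    then have "\<bar>x \<bullet> v\<bar> \<le> sqrt (1 + x \<bullet> x) * sqrt ?Q"
      by (simp flip: real_sqrt_mult add: real_le_rsqrt)
    moreover have "sqrt (1 + x \<bullet> x) > 0" by (simp add: add_pos_nonneg)
    ultimately show "\<bar>(x \<bullet> v) / sqrt (1 + x \<bullet> x)\<bar> \<le> 1 * sqrt ?Q"
      by (simp add: divide_le_eq mult.commute)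
  qed simp
  then show ?thesis by simp
qed

text \<open>The functions \<open>z \<mapsto> exp(-|z|\<^sup>2) (w \<bullet> z)\<close> separate the points of each circle around the origin,
  which the radial function of the previous estimate cannot do.\<close>

lemma cusp_dist_ge_angular:
  assumes w: "w \<noteq> 0"
  shows "\<bar>exp (- (y \<bullet> y)) * (w \<bullet> y) - exp (- (x \<bullet> x)) * (w \<bullet> x)\<bar>
    \<le> 11 * norm w * riem_dist cusp_metric x y"
proof (rule riem_dist_ge_Lipschitz[OF riemannian_cusp_metric])
  fix x :: "real^2"
  show "((\<lambda>x. exp (- (x \<bullet> x)) * (w \<bullet> x)) has_derivative
      (\<lambda>v. exp (- (x \<bullet> x)) * (w \<bullet> v - 2 * (x \<bullet> v) * (w \<bullet> x)))) (at x)"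
    by (auto intro!: derivative_eq_intros simp: fun_eq_iff inner_commute algebra_simps)
next
  fix x v :: "real^2"
  let ?Q = "v \<bullet> (cusp_metric x *v v)" and ?t = "x \<bullet> x"
  have t: "?t \<ge> 0" by simp
  have q: "?t + exp (- ?t) > 0" by (rule inner_plus_exp_pos)
  have "\<bar>w \<bullet> v - 2 * (x \<bullet> v) * (w \<bullet> x)\<bar> \<le> \<bar>w \<bullet> v\<bar> + 2 * (\<bar>x \<bullet> v\<bar> * \<bar>w \<bullet> x\<bar>)"
    by (simp add: abs_triangle_ineq4[THEN order_trans] abs_mult)
  also have "\<dots> \<le> norm w * norm v + 2 * ((norm x * norm v) * (norm w * norm x))"
    by (intro add_mono mult_left_mono mult_mono Cauchy_Schwarz_ineq2) auto
  also have "\<dots> = norm w * ((1 + 2 * ?t) * norm v)"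
    by (simp add: dot_square_norm power2_eq_square algebra_simps)
  finally have 1: "\<bar>w \<bullet> v - 2 * (x \<bullet> v) * (w \<bullet> x)\<bar> \<le> norm w * ((1 + 2 * ?t) * norm v)" .
  \<comment> \<open>The metric controls |v|^2 only up to the factor 1 + t exp(t). The factor exp(-t)
    of the test function has to make up for this.\<close>
  have "(v \<bullet> v) * exp (- ?t) \<le> ?Q * (?t + exp (- ?t))"
    using cusp_metric_ge[of v x] q by (simp add: field_simps)
  then have "exp ?t * ((v \<bullet> v) * exp (- ?t)) \<le> exp ?t * (?Q * (?t + exp (- ?t)))"
    by (intro mult_left_mono) auto
  then have "(v \<bullet> v) * (exp ?t * exp (- ?t)) \<le> ?Q * (exp ?t * exp (- ?t) + ?t * exp ?t)"
    by (simp only: algebra_simps)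
  then have 2: "v \<bullet> v \<le> ?Q * (1 + ?t * exp ?t)"
    by (simp flip: exp_add)
  have Q: "?Q \<ge> 0"
    using riemannian_cusp_metric by (cases "v = 0") (auto simp: riemannian_metric_def less_imp_le)
  \<comment> \<open>Chosen so that 1 + 2t \<le> 6s, 1 + t \<le> 3s and s^3 \<le> exp(t). This
    produces the constant 108, rounded up to the square 121 and giving the factor 11.\<close>
  define s where "s = 1 + ?t / 3"
  have s: "s \<ge> 1" "s ^ 3 \<le> exp ?t" using t cube_le_exp[OF t] by (auto simp: s_def)
  have "(1 + 2 * ?t)\<^sup>2 * (1 + ?t * exp ?t) \<le> (1 + 2 * ?t)\<^sup>2 * ((1 + ?t) * exp ?t)"
    using t by (intro mult_left_mono) (auto simp: algebra_simps)
  also have "\<dots> = ((1 + 2 * ?t)\<^sup>2 * (1 + ?t)) * exp ?t" by simp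
  also have "\<dots> \<le> ((6 * s)\<^sup>2 * (3 * s)) * exp ?t"
    using t by (intro mult_right_mono mult_mono power_mono) (auto simp: s_def)
  also have "\<dots> = 108 * s ^ 3 * exp ?t" by (simp add: power2_eq_square power3_eq_cube)
  also have "\<dots> \<le> 121 * exp ?t * exp ?t"
    using s by (intro mult_right_mono mult_mono) auto
  finally have 3: "(1 + 2 * ?t)\<^sup>2 * (1 + ?t * exp ?t) \<le> 121 * (exp ?t)\<^sup>2"
    by (simp add: power2_eq_square)
  have "((1 + 2 * ?t) * norm v)\<^sup>2 = (1 + 2 * ?t)\<^sup>2 * (v \<bullet> v)"
    by (simp add: power_mult_distrib dot_square_norm)
  also have "\<dots> \<le> (1 + 2 * ?t)\<^sup>2 * (?Q * (1 + ?t * exp ?t))"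
    by (intro mult_left_mono 2) auto
  also have "\<dots> = ((1 + 2 * ?t)\<^sup>2 * (1 + ?t * exp ?t)) * ?Q" by simp
  also have "\<dots> \<le> (121 * (exp ?t)\<^sup>2) * ?Q"
    by (intro mult_right_mono 3 Q)
  also have "\<dots> = (11 * exp ?t * sqrt ?Q)\<^sup>2"
    using Q by (simp add: power_mult_distrib)
  finally have "(1 + 2 * ?t) * norm v \<le> 11 * exp ?t * sqrt ?Q"
    by (rule power2_le_imp_le) (use Q in simp)
  then have "norm w * ((1 + 2 * ?t) * norm v) \<le> norm w * (11 * exp ?t * sqrt ?Q)"
    by (rule mult_left_mono) simp
  with 1 have "exp (- ?t) * \<bar>w \<bullet> v - 2 * (x \<bullet> v) * (w \<bullet> x)\<bar>
      \<le> exp (- ?t) * (norm w * (11 * exp ?t * sqrt ?Q))"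
    by (intro mult_left_mono) auto
  then show "\<bar>exp (- ?t) * (w \<bullet> v - 2 * (x \<bullet> v) * (w \<bullet> x))\<bar> \<le> 11 * norm w * sqrt ?Q"
    by (simp add: abs_mult exp_minus field_simps)
qed (use w in simp)

text \<open>At distance zero the radial estimate forces equal norms. The exponential factors in the
  angular estimate then agree, and the direction \<open>w = y - x\<close> yields |y - x|^2 =
  0.\<close>

lemma cusp_dist_eq_0: "riem_dist cusp_metric x y = 0 \<longleftrightarrow> x = y"
proof
  assume "x = y"
  then show "riem_dist cusp_metric x y = 0"
    using cusp_dist_le_norm[of x y] riem_dist_nonneg[OF riemannian_cusp_metric, of x y] by simp
next
  assume d: "riem_dist cusp_metric x y = 0"
  then have eq: "y \<bullet> y = x \<bullet> x"
    using cusp_dist_ge_radial[of y x] by simp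
  show "x = y"
  proof (rule ccontr)
    assume "x \<noteq> y"
    then have "y - x \<noteq> 0" by simp
    from cusp_dist_ge_angular[OF this, of y x]
    have "exp (- (x \<bullet> x)) * ((y - x) \<bullet> y) - exp (- (x \<bullet> x)) * ((y - x) \<bullet> x) = 0"
      by (simp add: d eq)
    then have "(y - x) \<bullet> (y - x) = 0"
      by (simp flip: right_diff_distrib inner_diff_right)
    with \<open>x \<noteq> y\<close> show False by simp
  qed
qed

section \<open>Metric space structure and completeness\<close>

interpretation cusp: Metric_space UNIV "riem_dist cusp_metric"
proof
  fix x y z
  show "0 \<le> riem_dist cusp_metric x y"
    by (rule riem_dist_nonneg[OF riemannian_cusp_metric])
  show "riem_dist cusp_metric x y = riem_dist cusp_metric y x"
    by (rule riem_dist_commute[OF riemannian_cusp_metric])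
  show "riem_dist cusp_metric x z \<le> riem_dist cusp_metric x y + riem_dist cusp_metric y z"
    by (rule riem_dist_triangle[OF riemannian_cusp_metric])
qed (simp add: cusp_dist_eq_0)

lemma norm_le_sqrt_one_plus: "norm x \<le> sqrt (1 + x \<bullet> x)"
  by (simp add: norm_eq_sqrt_inner)

text \<open>By the radial estimate a Cauchy sequence is bounded in the Euclidean norm, so a
  subsequence converges there. The distance is at most the Euclidean one, so this subsequence
  converges in the cusp metric too, and with it the whole Cauchy sequence.\<close>

lemma riem_complete_cusp: "riem_complete cusp_metric"
  unfolding riem_complete_def
proof
  show "Metric_space UNIV (riem_dist cusp_metric)" by (rule cusp.Metric_space_axioms)
  show "cusp.mcomplete"
    unfolding cusp.mcomplete_def
  proof (intro allI impI)
    fix \<sigma> assume C: "cusp.MCauchy \<sigma>"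
    then obtain N where N: "\<And>n. n \<ge> N \<Longrightarrow> riem_dist cusp_metric (\<sigma> N) (\<sigma> n) < 1"
      unfolding cusp.MCauchy_def by (meson order_refl zero_less_one)
    define \<tau> where "\<tau> n = \<sigma> (N + n)" for n
    have "norm (\<tau> n) \<le> sqrt (1 + \<sigma> N \<bullet> \<sigma> N) + 1" for n
      using norm_le_sqrt_one_plus[of "\<tau> n"] cusp_dist_ge_radial[of "\<tau> n" "\<sigma> N"] N[of "N + n"]
      by (simp add: \<tau>_def)
    then have "bounded (range \<tau>)" by (auto simp: bounded_iff)
    then obtain l r where r: "strict_mono r" and l: "(\<tau> \<circ> r) \<longlonglongrightarrow> l"
      using bounded_imp_convergent_subsequence by blast
    define \<rho> where "\<rho> n = N + r n" for n
    have \<rho>: "strict_mono \<rho>" using r by (simp add: \<rho>_def strict_mono_def)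
    have "(\<lambda>n. l - (\<tau> \<circ> r) n) \<longlonglongrightarrow> 0"
      using tendsto_diff[OF tendsto_const[of l] l] by simp
    then have "(\<lambda>n. norm (l - (\<tau> \<circ> r) n)) \<longlonglongrightarrow> 0"
      by (rule tendsto_norm_zero)
    then have "(\<lambda>n. riem_dist cusp_metric ((\<sigma> \<circ> \<rho>) n) l) \<longlonglongrightarrow> 0"
      by (rule Lim_null_comparison[rotated])
         (use cusp_dist_le_norm in \<open>auto simp: \<rho>_def \<tau>_def\<close>)
    then have "limitin cusp.mtopology (\<sigma> \<circ> \<rho>) l sequentially"
      by (simp add: cusp.limitin_metric_dist_null)
    with C \<rho> have "limitin cusp.mtopology \<sigma> l sequentially"
      by (rule cusp.MCauchy_convergent_subsequence)
    then show "\<exists>x. limitin cusp.mtopology \<sigma> x sequentially" ..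
  qed
qed

section \<open>Volume and the failure of doubling\<close>

lemma det_cusp_metric: "det (cusp_metric x) = 1 / (1 + (x \<bullet> x) * exp (x \<bullet> x))"
proof -
  have q: "x \<bullet> x + exp (- (x \<bullet> x)) > 0" by (rule inner_plus_exp_pos)
  have alg: "(1 - a * a / c) * (1 - b * b / c) - a * b / c * (b * a / c) = 1 - (b * b + a * a) / c"
    for a b c :: real
    by (simp add: algebra_simps add_divide_distrib)
  \<comment> \<open>The matrix is the identity minus a rank one matrix, so its determinant is 1
    minus the trace of the latter.\<close>
  have "det (cusp_metric x) = 1 - (x \<bullet> x) / (x \<bullet> x + exp (- (x \<bullet> x)))"
    unfolding det_2
    using alg[of "x $ 2" "x \<bullet> x + exp (- (x \<bullet> x))" "x $ 1"]
    by (simp add: cusp_metric_def perp_def inner_vec_def[of x x] sum_2)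
  also have "\<dots> = exp (- (x \<bullet> x)) / (x \<bullet> x + exp (- (x \<bullet> x)))"
    using q by (simp add: field_simps)
  also have "\<dots> = 1 / (1 + (x \<bullet> x) * exp (x \<bullet> x))"
    by (simp add: exp_minus field_simps)
  finally show ?thesis .
qed

text \<open>On the unit ball |x|^2 exp(|x|^2) \<le> 3, so the volume density is at least
  1/2.\<close>

lemma riem_vol_cusp_lower:
  assumes "ball 0 1 \<subseteq> A"
  shows "riem_vol cusp_metric A \<ge> ennreal (unit_ball_vol 2 / 2)"
proof -
  have "ennreal (unit_ball_vol 2 / 2) = ennreal (1/2 * unit_ball_vol 2)" by simp
  also have "\<dots> = ennreal (1/2) * ennreal (unit_ball_vol 2)"
    by (rule ennreal_mult) auto
  also have "\<dots> = ennreal (1/2) * emeasure lborel (ball (0::real^2) 1)"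
    by (simp add: emeasure_ball)
  also have "\<dots> = (\<integral>\<^sup>+x. ennreal (1/2) * indicator (ball 0 1) (x::real^2) \<partial>lborel)"
    by (simp add: nn_integral_cmult_indicator)
  also have "\<dots> \<le> riem_vol cusp_metric A"
    unfolding riem_vol_def
  proof (rule nn_integral_mono)
    fix x :: "real^2"
    show "ennreal (1/2) * indicator (ball 0 1) x \<le> ennreal (sqrt (det (cusp_metric x))) * indicator A x"
    proof (cases "x \<in> ball 0 1")
      case True
      then have t: "x \<bullet> x \<le> 1"
        by (simp add: dot_square_norm abs_square_le_1)
      then have "(x \<bullet> x) * exp (x \<bullet> x) \<le> 1 * 3"
        using exp_le exp_le_cancel_iff[of "x \<bullet> x" 1]
        by (intro mult_mono) (auto intro: order_trans)
      moreover have "(x \<bullet> x) * exp (x \<bullet> x) \<ge> 0" by simp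
      ultimately have "1 / 4 \<le> 1 / (1 + (x \<bullet> x) * exp (x \<bullet> x))"
        by (intro frac_le) linarith+
      then have "(1/2)\<^sup>2 \<le> det (cusp_metric x)"
        by (simp add: det_cusp_metric power2_eq_square)
      then have "1/2 \<le> sqrt (det (cusp_metric x))" by (rule real_le_rsqrt)
      with True subsetD[OF assms True] show ?thesis
        by (simp only: indicator_simps mult_1_right ennreal_leI)
    qed simp
  qed
  finally show ?thesis .
qed

text \<open>With t = |x|^2, the cubic bound gives t exp(t) \<ge> t^4/27. Rounding 27 up to the
  square 36 bounds the volume density by 6/m^2.\<close>

lemma riem_vol_cusp_upper:
  assumes sub: "A \<subseteq> ball 0 r" and r: "r \<ge> 0" and m: "m > 0" and A: "\<And>x. x \<in> A \<Longrightarrow> x \<bullet> x \<ge> m"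
  shows "riem_vol cusp_metric A \<le> ennreal (6 / m\<^sup>2 * (unit_ball_vol 2 * r\<^sup>2))"
proof -
  have "riem_vol cusp_metric A \<le> (\<integral>\<^sup>+x. ennreal (6 / m\<^sup>2) * indicator (ball 0 r) (x::real^2) \<partial>lborel)"
    unfolding riem_vol_def
  proof (rule nn_integral_mono)
    fix x :: "real^2"
    show "ennreal (sqrt (det (cusp_metric x))) * indicator A x \<le> ennreal (6 / m\<^sup>2) * indicator (ball 0 r) x"
    proof (cases "x \<in> A")
      case True
      let ?t = "x \<bullet> x"
      have t: "?t \<ge> m" using A True by simp
      then have t0: "?t > 0" by (rule less_le_trans[OF m])
      have "(?t / 3) ^ 3 \<le> exp ?t"
        using t0 by (intro order_trans[OF power_mono cube_le_exp]) auto
      then have e: "?t * (?t / 3) ^ 3 \<le> ?t * exp ?t" using t0 by simp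
      have "(m\<^sup>2)\<^sup>2 \<le> (?t\<^sup>2)\<^sup>2" using t m by (intro power_mono) auto
      also have "\<dots> = 27 * (?t * (?t / 3) ^ 3)"
        by (simp add: power2_eq_square power3_eq_cube)
      also have "\<dots> \<le> 27 * (?t * exp ?t)" using e by simp
      also have "\<dots> \<le> 36 * (1 + ?t * exp ?t)" using t0 by (simp add: algebra_simps)
      finally have "(m\<^sup>2)\<^sup>2 \<le> 36 * (1 + ?t * exp ?t)" .
      then have "det (cusp_metric x) \<le> (6 / m\<^sup>2)\<^sup>2"
        using m t0 by (simp add: det_cusp_metric power_divide divide_simps add_pos_pos)
      then have "sqrt (det (cusp_metric x)) \<le> 6 / m\<^sup>2"
        by (rule real_le_lsqrt[rotated]) simp
      with True sub show ?thesis by (auto simp: indicator_def intro!: ennreal_leI)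
    qed simp
  qed
  also have "\<dots> = ennreal (6 / m\<^sup>2) * emeasure lborel (ball (0::real^2) r)"
    by (simp add: nn_integral_cmult_indicator)
  also have "\<dots> = ennreal (6 / m\<^sup>2 * (unit_ball_vol 2 * r\<^sup>2))"
    using r by (simp add: emeasure_ball flip: ennreal_mult')
  finally show ?thesis .
qed

lemma cusp_not_doubling:
  "\<not> (\<exists>\<kappa>::real. \<forall>p. \<forall>R>0.
     riem_vol cusp_metric (riem_ball cusp_metric p (2 * R))
       \<le> ennreal \<kappa> * riem_vol cusp_metric (riem_ball cusp_metric p R))"
proof
  assume "\<exists>\<kappa>::real. \<forall>p. \<forall>R>0. riem_vol cusp_metric (riem_ball cusp_metric p (2 * R))
       \<le> ennreal \<kappa> * riem_vol cusp_metric (riem_ball cusp_metric p R)"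
  then obtain \<kappa>0 :: real where \<kappa>0: "\<And>p R. R > 0 \<Longrightarrow> riem_vol cusp_metric (riem_ball cusp_metric p (2 * R))
       \<le> ennreal \<kappa>0 * riem_vol cusp_metric (riem_ball cusp_metric p R)" by blast
  \<comment> \<open>\<open>ennreal\<close> sends negative reals to 0, so the constant may be taken
    nonnegative.\<close>
  define \<kappa> where "\<kappa> = max 0 \<kappa>0"
  have \<kappa>: "\<kappa> \<ge> 0" "ennreal \<kappa>0 = ennreal \<kappa>" by (auto simp: \<kappa>_def max_def ennreal_neg)
  \<comment> \<open>The volume comparison will give N^2 \<le> 6912 \<kappa>, which this choice
    contradicts; N \<ge> 8 serves the numerical bounds on the small ball.\<close>
  define N where "N = 8 + 6912 * \<kappa>"
  have N: "N \<ge> 8" using \<kappa> by (simp add: N_def)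
  define p :: "real^2" where "p = vector [N, 0]"
  define R where "R = (N + 1) / 2"
  have R: "R > 0" "2 * R = N + 1" using N by (auto simp: R_def)
  have pp: "p \<bullet> p = N\<^sup>2" by (simp add: p_def inner_vec_def sum_2 power2_eq_square)
  then have np: "norm p = N" using N by (simp add: norm_eq_sqrt_inner)
  have "ball 0 1 \<subseteq> riem_ball cusp_metric p (2 * R)"
  proof
    fix x :: "real^2" assume "x \<in> ball 0 1"
    then have "norm (x - p) < N + 1" using norm_triangle_ineq4[of x p] np by simp
    then show "x \<in> riem_ball cusp_metric p (2 * R)"
      using cusp_dist_le_norm[of p x] R by (simp add: riem_ball_def)
  qed
  then have low: "ennreal (unit_ball_vol 2 / 2) \<le> riem_vol cusp_metric (riem_ball cusp_metric p (2 * R))"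
    by (rule riem_vol_cusp_lower)
  have sq: "N \<le> sqrt (1 + N\<^sup>2)" "sqrt (1 + N\<^sup>2) \<le> N + 1"
    using N by (auto intro!: real_le_rsqrt real_le_lsqrt simp: power2_eq_square algebra_simps)
  \<comment> \<open>On the small ball sqrt(1 + |x|^2) lies between (N - 1)/2 and 3(N + 1)/2, so the
    ball sits in a shell whose radii are of order N.\<close>
  have x: "norm x < 3 * N" "x \<bullet> x \<ge> N\<^sup>2 / 8" if "x \<in> riem_ball cusp_metric p R" for x
  proof -
    have "\<bar>sqrt (1 + x \<bullet> x) - sqrt (1 + N\<^sup>2)\<bar> < (N + 1) / 2"
      using cusp_dist_ge_radial[of x p] that by (simp add: riem_ball_def pp R_def)
    then have a: "sqrt (1 + x \<bullet> x) - sqrt (1 + N\<^sup>2) < (N + 1) / 2"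
      "sqrt (1 + N\<^sup>2) - sqrt (1 + x \<bullet> x) < (N + 1) / 2"
      by (simp_all only: abs_less_iff minus_diff_eq)
    have b: "sqrt (1 + x \<bullet> x) < 3 * (N + 1) / 2"
      using a(1) sq(2) by (simp add: field_simps)
    have c: "sqrt (1 + x \<bullet> x) > (N - 1) / 2"
      using a(2) sq(1) by (simp add: field_simps)
    show "norm x < 3 * N" using b norm_le_sqrt_one_plus[of x] N by simp
    have "((N - 1) / 2)\<^sup>2 \<le> (sqrt (1 + x \<bullet> x))\<^sup>2"
      using c N by (intro power_mono) auto
    then have "((N - 1) / 2)\<^sup>2 \<le> 1 + x \<bullet> x" by simp
    \<comment> \<open>Expanded in powers of N and N - 8, so that nonnegativity is visible
      termwise.\<close>
    moreover have "((N - 1) / 2)\<^sup>2 - 1 - N\<^sup>2 / 8 = (N * (N - 8) + 4 * (N - 8) + 26) / 8"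
      by (simp add: power2_eq_square field_simps)
    moreover have "(N * (N - 8) + 4 * (N - 8) + 26) / 8 \<ge> 0"
      using N by (intro divide_nonneg_pos add_nonneg_nonneg mult_nonneg_nonneg) auto
    ultimately show "x \<bullet> x \<ge> N\<^sup>2 / 8" by linarith
  qed
  have "riem_vol cusp_metric (riem_ball cusp_metric p R)
      \<le> ennreal (6 / (N\<^sup>2 / 8)\<^sup>2 * (unit_ball_vol 2 * (3 * N)\<^sup>2))"
    using x N by (intro riem_vol_cusp_upper) auto
  also have "6 / (N\<^sup>2 / 8)\<^sup>2 * (unit_ball_vol 2 * (3 * N)\<^sup>2) = 3456 * unit_ball_vol 2 / N\<^sup>2"
    using N by (simp add: power2_eq_square field_simps)
  finally have up: "riem_vol cusp_metric (riem_ball cusp_metric p R) \<le> ennreal (3456 * unit_ball_vol 2 / N\<^sup>2)" .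
  have "ennreal (unit_ball_vol 2 / 2) \<le> ennreal \<kappa> * riem_vol cusp_metric (riem_ball cusp_metric p R)"
    using order_trans[OF low \<kappa>0[OF R(1), of p]] \<kappa>(2) by simp
  also have "\<dots> \<le> ennreal \<kappa> * ennreal (3456 * unit_ball_vol 2 / N\<^sup>2)"
    by (intro mult_left_mono up) simp
  also have "\<dots> = ennreal (\<kappa> * (3456 * unit_ball_vol 2 / N\<^sup>2))"
    using \<kappa>(1) by (intro ennreal_mult[symmetric]) auto
  finally have "unit_ball_vol 2 / 2 \<le> \<kappa> * (3456 * unit_ball_vol 2 / N\<^sup>2)"
    using \<kappa>(1) by (subst (asm) ennreal_le_iff) auto
  then have "unit_ball_vol 2 * N\<^sup>2 \<le> unit_ball_vol 2 * (6912 * \<kappa>)"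
    using N by (simp add: field_simps)
  then have "N\<^sup>2 \<le> 6912 * \<kappa>" by simp
  moreover have "N * 1 \<le> N * N" using N by (intro mult_left_mono) auto
  ultimately show False by (simp add: N_def power2_eq_square)
qed

subsection \<open>Harmonic functions on the cusp\<close>

lemma polar_nth [simp]: "polar r \<theta> $ 1 = r * cos \<theta>" "polar r \<theta> $ 2 = r * sin \<theta>"
  by (simp_all add: polar_def)

lemma norm_polar: "r \<ge> 0 \<Longrightarrow> norm (polar r \<theta>) = r"
proof -
  assume r: "r \<ge> 0"
  have "polar r \<theta> \<bullet> polar r \<theta> = r\<^sup>2 * ((sin \<theta>)\<^sup>2 + (cos \<theta>)\<^sup>2)"
    unfolding inner_vec_def sum_2 polar_nth inner_real_def by algebra
  then show ?thesis using r by (simp add: norm_eq_sqrt_inner)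
qed

text \<open>The angle is taken from [0, 2 pi], the range of the angular integrals used
  later.\<close>

lemma ex_polar:
  obtains r \<theta> where "r \<ge> 0" "0 \<le> \<theta>" "\<theta> \<le> 2 * pi" "x = polar r \<theta>"
proof (cases "x = 0")
  case True
  then have "x = polar 0 0" by (simp add: vec_eq_iff forall_2)
  then show ?thesis using that[of 0 0] by simp
next
  case False
  have "(norm x)\<^sup>2 = (x $ 1)\<^sup>2 + (x $ 2)\<^sup>2"
    by (simp add: norm_eq_sqrt_inner inner_vec_def sum_2 power2_eq_square)
  then have "(x $ 1 / norm x)\<^sup>2 + (x $ 2 / norm x)\<^sup>2 = 1"
    using False by (metis add_divide_distrib divide_self norm_eq_zero power_divide power_not_zero)
  then obtain t where t: "0 \<le> t" "t < 2 * pi" "x $ 1 / norm x = cos t" "x $ 2 / norm x = sin t"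
    by (rule sincos_total_2pi)
  have "x = polar (norm x) t"
    using False by (simp add: vec_eq_iff forall_2 flip: t(3,4))
  then show ?thesis using that[of "norm x" t] t by simp
qed

lemma polar_has_vector_derivative:
  "((\<lambda>s. polar s \<theta>) has_vector_derivative polar_dr r \<theta>) (at r)"
  "(polar r has_vector_derivative polar_dtheta r \<theta>) (at \<theta>)"
  unfolding has_vector_derivative_def has_derivative_componentwise_within[where f = "\<lambda>s. polar s \<theta>"]
    has_derivative_componentwise_within[where f = "polar r"]
  by (auto simp: Basis_vec_def inner_axis polar_dr_def polar_dtheta_def forall_2
      intro!: derivative_eq_intros)

lemma continuous_on_polar: "continuous_on S (\<lambda>(r, \<theta>). polar r \<theta>)"
proof -
  have "continuous_on S (\<lambda>z. polar (fst z) (snd z))"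
    by (subst continuous_on_componentwise)
       (auto simp: Basis_vec_def inner_axis forall_2 intro!: continuous_intros)
  then show ?thesis by (simp add: split_beta)
qed

text \<open>The polar derivatives are trigonometric combinations of Cartesian partial derivatives,
  with factors of \<open>r\<close> in the angular ones. Hence they are jointly continuous, also at
  \<open>r = 0\<close>, as differentiation under the integral and continuity of the flux at the
  origin require.\<close>

lemma Ck_2_polar_derivatives:
  fixes u :: "real^2 \<Rightarrow> real"
  assumes u: "Ck 2 u"
  obtains ur urr ut utt :: "real \<Rightarrow> real \<Rightarrow> real"
  where "\<And>r \<theta>. ((\<lambda>s. u (polar s \<theta>)) has_real_derivative ur r \<theta>) (at r)"
    "\<And>r \<theta>. ((\<lambda>s. ur s \<theta>) has_real_derivative urr r \<theta>) (at r)"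
    "\<And>r \<theta>. ((\<lambda>t. u (polar r t)) has_real_derivative ut r \<theta>) (at \<theta>)"
    "\<And>r \<theta>. ((\<lambda>t. ut r t) has_real_derivative utt r \<theta>) (at \<theta>)"
    "\<And>S. continuous_on S (\<lambda>(r, \<theta>). ur r \<theta>)"
    "\<And>S. continuous_on S (\<lambda>(r, \<theta>). urr r \<theta>)"
    "\<And>S. continuous_on S (\<lambda>(r, \<theta>). ut r \<theta>)"
    "\<And>S. continuous_on S (\<lambda>(r, \<theta>). utt r \<theta>)"
    "\<And>r. ut r (2 * pi) = ut r 0"
proof -
  let ?e1 = "axis 1 1 :: real^2" and ?e2 = "axis 2 1 :: real^2"
  \<comment> \<open>Reduces a derivative in the moving polar directions to derivatives in two fixed
    directions, which are again \<open>Ck\<close> functions of the point.\<close>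
  have dec: "v = (v $ 1) *\<^sub>R ?e1 + (v $ 2) *\<^sub>R ?e2" for v :: "real^2"
    by (simp add: vec_eq_iff forall_2 axis_def)
  have Df: "f' v = v $ 1 * f' ?e1 + v $ 2 * f' ?e2"
    if "(f has_derivative f') (at x)" for f :: "real^2 \<Rightarrow> real" and f' x v
  proof -
    have l: "linear f'" using has_derivative_linear[OF that] .
    have "f' v = f' ((v $ 1) *\<^sub>R ?e1 + (v $ 2) *\<^sub>R ?e2)" using dec[of v] by simp
    then show ?thesis by (simp add: linear_add[OF l] linear_scale[OF l])
  qed
  define D where "D v f x = frechet_derivative f (at x) v" for v :: "real^2" and f :: "real^2 \<Rightarrow> real" and x
  have D: "(f has_derivative (\<lambda>v. v $ 1 * D ?e1 f x + v $ 2 * D ?e2 f x)) (at x)"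
    if f: "Ck (Suc k) f" for f k x
  proof -
    have "(f has_derivative frechet_derivative f (at x)) (at x)" by (rule Ck_SucD(1)[OF f])
    moreover from Df[OF this] have "frechet_derivative f (at x) = (\<lambda>v. v $ 1 * D ?e1 f x + v $ 2 * D ?e2 f x)"
      unfolding D_def by blast
    ultimately show ?thesis by simp
  qed
  have dr: "((\<lambda>s. f (polar s \<theta>)) has_real_derivative
      cos \<theta> * D ?e1 f (polar r \<theta>) + sin \<theta> * D ?e2 f (polar r \<theta>)) (at r)"
    if f: "Ck (Suc k) f" for f k r \<theta>
    using diff_chain_at[OF polar_has_vector_derivative(1)[unfolded has_vector_derivative_def] D[OF f], of \<theta> r]
    by (auto simp: o_def has_field_derivative_def polar_dr_def algebra_simps elim!: has_derivative_eq_rhs)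
  have dt: "((\<lambda>t. f (polar r t)) has_real_derivative
      - r * sin \<theta> * D ?e1 f (polar r \<theta>) + r * cos \<theta> * D ?e2 f (polar r \<theta>)) (at \<theta>)"
    if f: "Ck (Suc k) f" for f k r \<theta>
    using diff_chain_at[OF polar_has_vector_derivative(2)[unfolded has_vector_derivative_def] D[OF f], of r \<theta>]
    by (auto simp: o_def has_field_derivative_def polar_dtheta_def algebra_simps elim!: has_derivative_eq_rhs)
  have u2: "Ck (Suc (Suc 0)) u" using u by (simp add: numeral_2_eq_2)
  have A: "Ck (Suc 0) (D v u)" for v
    using Ck_SucD(2)[OF u2] unfolding D_def[abs_def] .
  have AA: "Ck 0 (D w (D v u))" for v w
    using Ck_SucD(2)[OF A] unfolding D_def[of w, abs_def] .
  have c0: "continuous_on S (\<lambda>z. f (polar (fst z) (snd z)))" if "Ck 0 f" for f :: "real^2 \<Rightarrow> real" and S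
    using continuous_on_compose2[OF that[unfolded Ck.simps(1)] continuous_on_polar, of S]
    by (simp add: split_beta)
  have per: "polar r (2 * pi) = polar r 0" for r by (simp add: polar_def)
  note cc = c0[OF AA] c0[OF Ck_Suc_imp_Ck[OF A]]
  show thesis
  proof (rule that)
    show "((\<lambda>s. u (polar s \<theta>)) has_real_derivative
        cos \<theta> * D ?e1 u (polar r \<theta>) + sin \<theta> * D ?e2 u (polar r \<theta>)) (at r)" for r \<theta>
      by (rule dr[OF u2])
    show "((\<lambda>t. u (polar r t)) has_real_derivative
        - r * sin \<theta> * D ?e1 u (polar r \<theta>) + r * cos \<theta> * D ?e2 u (polar r \<theta>)) (at \<theta>)" for r \<theta>
      by (rule dt[OF u2])
    show "((\<lambda>s. cos \<theta> * D ?e1 u (polar s \<theta>) + sin \<theta> * D ?e2 u (polar s \<theta>)) has_real_derivative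
        cos \<theta> * (cos \<theta> * D ?e1 (D ?e1 u) (polar r \<theta>) + sin \<theta> * D ?e2 (D ?e1 u) (polar r \<theta>))
        + sin \<theta> * (cos \<theta> * D ?e1 (D ?e2 u) (polar r \<theta>) + sin \<theta> * D ?e2 (D ?e2 u) (polar r \<theta>))) (at r)"
      for r \<theta>
      by (intro DERIV_add DERIV_cmult dr[OF A])
    show "((\<lambda>t. - r * sin t * D ?e1 u (polar r t) + r * cos t * D ?e2 u (polar r t)) has_real_derivative
        - r * cos \<theta> * D ?e1 u (polar r \<theta>)
        + (- r * sin \<theta> * D ?e1 (D ?e1 u) (polar r \<theta>) + r * cos \<theta> * D ?e2 (D ?e1 u) (polar r \<theta>)) * (- r * sin \<theta>)
        + (- r * sin \<theta> * D ?e2 u (polar r \<theta>)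
        + (- r * sin \<theta> * D ?e1 (D ?e2 u) (polar r \<theta>) + r * cos \<theta> * D ?e2 (D ?e2 u) (polar r \<theta>)) * (r * cos \<theta>)))
        (at \<theta>)" for r \<theta>
      by (intro DERIV_add DERIV_mult dt[OF A]) (auto intro!: derivative_eq_intros)
  qed (auto simp: split_beta per intro!: continuous_intros cc)
qed

section \<open>Decay of the profile against polynomial growth\<close>

lemma cusp_radius_le: "r \<ge> 0 \<Longrightarrow> cusp_radius r \<le> 2 * exp (- r)"
proof -
  assume r: "r \<ge> 0"
  have q: "1 + r\<^sup>2 * exp (r\<^sup>2) > 0" by (simp add: add_pos_nonneg)
  \<comment> \<open>Gives exp(2r) \<le> e exp(r^2) \<le> 4 exp(r^2), from which the factor 2 in the
    bound comes.\<close>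
  have "0 \<le> (r - 1)\<^sup>2" by simp
  then have "2 * r - 1 \<le> r\<^sup>2" by (simp add: power2_eq_square algebra_simps)
  then have "exp (2 * r - 1) \<le> exp (r\<^sup>2)" by simp
  then have "exp 1 * exp (2 * r - 1) \<le> 4 * exp (r\<^sup>2)"
    using exp_le by (intro mult_mono) auto
  then have "(exp r)\<^sup>2 \<le> 4 * exp (r\<^sup>2)"
    by (simp flip: exp_add exp_double)
  then have "r\<^sup>2 * (exp r)\<^sup>2 \<le> r\<^sup>2 * (4 * exp (r\<^sup>2))"
    by (rule mult_left_mono) simp
  then have "(r * exp r)\<^sup>2 \<le> 2\<^sup>2 * (1 + r\<^sup>2 * exp (r\<^sup>2))"
    by (simp add: power_mult_distrib)
  then have "r * exp r \<le> sqrt (2\<^sup>2 * (1 + r\<^sup>2 * exp (r\<^sup>2)))"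
    by (rule real_le_rsqrt)
  also have "\<dots> = 2 * sqrt (1 + r\<^sup>2 * exp (r\<^sup>2))"
    by (simp only: real_sqrt_mult) simp
  finally have "r * exp r \<le> 2 * sqrt (1 + r\<^sup>2 * exp (r\<^sup>2))" .
  then show ?thesis
    using q by (simp add: cusp_radius_def exp_minus field_simps)
qed

lemma cusp_radius_differentiable: "(cusp_radius has_real_derivative deriv cusp_radius r) (at r)"
proof -
  have q: "1 + r\<^sup>2 * exp (r\<^sup>2) > 0" by (simp add: add_pos_nonneg)
  then have "\<exists>D. (cusp_radius has_real_derivative D) (at r)"
    unfolding cusp_radius_def[abs_def] by (auto intro!: exI derivative_eq_intros)
  then show ?thesis using DERIV_imp_deriv by blast
qed

lemma continuous_on_cusp_radius: "continuous_on S cusp_radius"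
  using cusp_radius_differentiable DERIV_isCont continuous_at_imp_continuous_on by blast

text \<open>The function E(r) - c exp(r) is nondecreasing. Dividing the resulting lower bound and
  the polynomial upper bound by exp(r) traps c below a quantity tending to 0.\<close>

lemma not_exp_growth_of_poly_bound:
  fixes E :: "real \<Rightarrow> real"
  assumes r0: "r0 \<ge> 0" and c: "c > 0"
    and dE: "\<And>r. r \<ge> r0 \<Longrightarrow> (E has_real_derivative E' r) (at r)"
    and E': "\<And>r. r \<ge> r0 \<Longrightarrow> E' r \<ge> c * exp r"
    and bound: "\<And>r. r \<ge> r0 \<Longrightarrow> E r \<le> M * (1 + r) ^ k"
  shows False
proof -
  define a where "a = E r0 - c * exp r0"
  have low: "a + c * exp r \<le> E r" if "r \<ge> r0" for r
  proof -
    have "E r0 - c * exp r0 \<le> E r - c * exp r"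
    proof (rule DERIV_nonneg_imp_nondecreasing[OF that])
      fix s assume "r0 \<le> s" "s \<le> r"
      then show "\<exists>y. ((\<lambda>r. E r - c * exp r) has_real_derivative y) (at s) \<and> 0 \<le> y"
        using E'[of s] by (intro exI[of _ "E' s - c * exp s"]) (auto intro!: derivative_eq_intros dE)
    qed
    then show ?thesis by (simp add: a_def)
  qed
  \<comment> \<open>The exponential is shifted to the variable 1 + r of the power; the factor exp 1
    undoes the shift.\<close>
  have "((\<lambda>r. M * ((1 + r) ^ k / exp (1 + r)) * exp 1 - a * exp (- r)) \<longlongrightarrow> M * 0 * exp 1 - a * 0) at_top"
  proof (intro tendsto_intros)
    show "((\<lambda>r::real. (1 + r) ^ k / exp (1 + r)) \<longlongrightarrow> 0) at_top"
      by (rule filterlim_compose[OF tendsto_power_div_exp_0 filterlim_tendsto_add_at_top])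
         (auto intro: filterlim_ident)
    show "((\<lambda>r::real. exp (- r)) \<longlongrightarrow> 0) at_top"
      by (rule filterlim_compose[OF exp_at_bot filterlim_uminus_at_bot_at_top])
  qed
  moreover have "eventually (\<lambda>r. c \<le> M * ((1 + r) ^ k / exp (1 + r)) * exp 1 - a * exp (- r)) at_top"
  proof (rule eventually_mono[OF eventually_ge_at_top[of r0]])
    fix r assume "r0 \<le> r"
    then have "a + c * exp r \<le> M * (1 + r) ^ k"
      using low bound by (meson order_trans)
    then show "c \<le> M * ((1 + r) ^ k / exp (1 + r)) * exp 1 - a * exp (- r)"
      by (simp add: exp_add exp_minus field_simps)
  qed
  ultimately have "c \<le> M * 0 * exp 1 - a * 0"
    by (rule tendsto_lowerbound) simp
  with c show False by simp
qed

text \<open>Growth is measured by the Euclidean norm, which dominates the distance to the origin, so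
  the spaces H_d are covered. The case \<open>d = 0\<close> covers bounded functions.\<close>

lemma harmonic_cusp_poly_growth_imp_const:
  assumes u: "harmonic cusp_radius u"
    and growth: "\<And>x. \<bar>u x\<bar> \<le> C * (1 + norm x) ^ d"
  shows "u x = u 0"
proof -
  have u2: "Ck 2 u" and lap: "\<And>r \<theta>. r > 0 \<Longrightarrow> laplacian cusp_radius u r \<theta> = 0"
    using u by (auto simp: harmonic_def)
  obtain ur urr ut utt :: "real \<Rightarrow> real \<Rightarrow> real" where
    ur: "\<And>r \<theta>. ((\<lambda>s. u (polar s \<theta>)) has_real_derivative ur r \<theta>) (at r)" and
    urr: "\<And>r \<theta>. ((\<lambda>s. ur s \<theta>) has_real_derivative urr r \<theta>) (at r)" and
    ut: "\<And>r \<theta>. ((\<lambda>t. u (polar r t)) has_real_derivative ut r \<theta>) (at \<theta>)" and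
    utt: "\<And>r \<theta>. ((\<lambda>t. ut r t) has_real_derivative utt r \<theta>) (at \<theta>)" and
    cont: "\<And>S. continuous_on S (\<lambda>(r, \<theta>). ur r \<theta>)" "\<And>S. continuous_on S (\<lambda>(r, \<theta>). urr r \<theta>)"
      "\<And>S. continuous_on S (\<lambda>(r, \<theta>). ut r \<theta>)" "\<And>S. continuous_on S (\<lambda>(r, \<theta>). utt r \<theta>)" and
    per: "\<And>r. ut r (2 * pi) = ut r 0"
    using Ck_2_polar_derivatives[OF u2] by blast
  define U where "U r \<theta> = u (polar r \<theta>)" for r \<theta>
  define \<phi> where "\<phi> = cusp_radius"
  note dU = ur[folded U_def] ut[folded U_def]
  have "Ck 0 u" using Ck_Suc_imp_Ck[OF Ck_Suc_imp_Ck] u2 by (simp only: numeral_2_eq_2)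
  then have "continuous_on UNIV u" by simp
  then have cU: "continuous_on S (\<lambda>(r, \<theta>). U r \<theta>)" for S
    using continuous_on_compose2[of UNIV u S "\<lambda>(r, \<theta>). polar r \<theta>"] continuous_on_polar
    by (simp add: U_def split_beta)
  have c2: "continuous_on S (\<lambda>x. f (a x) (b x))"
    if "\<And>S. continuous_on S (\<lambda>(r, \<theta>). f r \<theta>)" "continuous_on S a" "continuous_on S b"
    for f :: "real \<Rightarrow> real \<Rightarrow> real" and a b :: "'z::topological_space \<Rightarrow> real" and S
    using continuous_on_compose2[OF that(1)[of UNIV] continuous_on_Pair[OF that(2,3)]] by simp
  note ci = c2[OF cU] c2[OF cont(1)] c2[OF cont(2)] c2[OF cont(3)] c2[OF cont(4)] continuous_intros
  have c\<phi>: "continuous_on S (\<lambda>x. \<phi> (a x))" if "continuous_on S a" for a :: "'z::topological_space \<Rightarrow> real" and S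
    using continuous_on_compose2[OF continuous_on_cusp_radius[of UNIV] that] by (simp add: \<phi>_def)
  have \<phi>: "\<phi> r > 0" if "r > 0" for r
    using cusp_radius_pos[OF that] by (simp add: \<phi>_def)
  \<comment> \<open>The Laplace equation multiplied by \<phi>; the left side is the radial
    derivative of \<phi> times \<open>ur\<close>.\<close>
  have eq: "\<phi> r * urr r \<theta> + deriv \<phi> r * ur r \<theta> = - utt r \<theta> / \<phi> r" if r: "r > 0" for r \<theta>
  proof -
    have "deriv (\<lambda>s. u (polar s \<theta>)) = (\<lambda>s. ur s \<theta>)" "deriv (\<lambda>t. u (polar r t)) = ut r"
      using ur ut by (auto intro!: ext DERIV_imp_deriv)
    then have "urr r \<theta> + deriv \<phi> r / \<phi> r * ur r \<theta> + 1 / (\<phi> r)\<^sup>2 * utt r \<theta> = 0"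
      using lap[OF r, of \<theta>] DERIV_imp_deriv[OF urr, of \<theta> r] DERIV_imp_deriv[OF utt, of r \<theta>] ur[of \<theta> r]
      by (simp add: laplacian_def numeral_2_eq_2 \<phi>_def DERIV_imp_deriv)
    then show ?thesis
      using \<phi>[OF r] by (simp add: field_simps power2_eq_square)
  qed
  let ?I = "\<lambda>f. integral (cbox 0 (2 * pi)) f"
  have ion: "f integrable_on cbox 0 (2 * pi)" if "continuous_on UNIV f" for f :: "real \<Rightarrow> real"
    by (rule integrable_continuous[OF continuous_on_subset[OF that subset_UNIV]])
  \<comment> \<open>\<open>F = \<phi> E'\<close>; \<open>F' \<ge> 0\<close> comes from the equation and an integration by parts in the angle.\<close>
  define E where "E r = ?I (\<lambda>\<theta>. (U r \<theta>)\<^sup>2)" for r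
  define F where "F r = ?I (\<lambda>\<theta>. 2 * \<phi> r * U r \<theta> * ur r \<theta>)" for r
  have dE: "(E has_real_derivative F r / \<phi> r) (at r)" if r: "r > 0" for r
  proof -
    have "((\<lambda>r. ?I (\<lambda>\<theta>. (U r \<theta>)\<^sup>2)) has_real_derivative ?I (\<lambda>\<theta>. 2 * U r \<theta> * ur r \<theta>)) (at r within UNIV)"
    proof (rule leibniz_rule_field_derivative)
      show "((\<lambda>r. (U r \<theta>)\<^sup>2) has_real_derivative 2 * U s \<theta> * ur s \<theta>) (at s)" for s \<theta>
        by (auto intro!: derivative_eq_intros dU)
      show "(\<lambda>\<theta>. (U s \<theta>)\<^sup>2) integrable_on cbox 0 (2 * pi)" for s
        by (intro ion ci)
      show "continuous_on (UNIV \<times> cbox 0 (2 * pi)) (\<lambda>(r, \<theta>). 2 * U r \<theta> * ur r \<theta>)"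
        unfolding split_beta by (intro ci)
    qed auto
    moreover have "F r / \<phi> r = ?I (\<lambda>\<theta>. 2 * U r \<theta> * ur r \<theta>)"
      using \<phi>[OF r] unfolding F_def by (simp add: mult.assoc mult.left_commute[of _ "\<phi> r"])
    ultimately show ?thesis by (simp add: E_def[abs_def])
  qed
  \<comment> \<open>The boundary terms cancel because \<open>U\<close> and \<open>ut\<close> take
    equal values at the angles 0 and 2 pi.\<close>
  have parts: "?I (\<lambda>\<theta>. U r \<theta> * utt r \<theta>) = - ?I (\<lambda>\<theta>. (ut r \<theta>)\<^sup>2)" for r
  proof -
    have "((\<lambda>\<theta>. (ut r \<theta>)\<^sup>2 + U r \<theta> * utt r \<theta>) has_integral U r (2 * pi) * ut r (2 * pi) - U r 0 * ut r 0) {0..2 * pi}"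
    proof (rule fundamental_theorem_of_calculus)
      fix \<theta>
      have "((\<lambda>\<theta>. U r \<theta> * ut r \<theta>) has_real_derivative (ut r \<theta>)\<^sup>2 + U r \<theta> * utt r \<theta>) (at \<theta>)"
        by (auto intro!: derivative_eq_intros dU utt simp: power2_eq_square)
      then show "((\<lambda>\<theta>. U r \<theta> * ut r \<theta>) has_vector_derivative (ut r \<theta>)\<^sup>2 + U r \<theta> * utt r \<theta>) (at \<theta> within {0..2 * pi})"
        by (simp add: has_real_derivative_iff_has_vector_derivative has_vector_derivative_at_within)
    qed simp
    moreover have "U r (2 * pi) = U r 0" by (simp add: U_def polar_def)
    ultimately have "?I (\<lambda>\<theta>. (ut r \<theta>)\<^sup>2 + U r \<theta> * utt r \<theta>) = 0"
      using per by (simp add: integral_unique)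
    moreover have "?I (\<lambda>\<theta>. (ut r \<theta>)\<^sup>2 + U r \<theta> * utt r \<theta>) = ?I (\<lambda>\<theta>. (ut r \<theta>)\<^sup>2) + ?I (\<lambda>\<theta>. U r \<theta> * utt r \<theta>)"
      by (intro integral_add ion ci)
    ultimately show ?thesis by simp
  qed
  \<comment> \<open>\<open>G\<close> and \<open>H\<close> are the radial and angular contributions
    to the energy on the circle of radius \<open>r\<close>, up to the weight of \<open>H\<close> in
    the derivative of \<open>F\<close>.\<close>
  define G where "G r = ?I (\<lambda>\<theta>. 2 * \<phi> r * (ur r \<theta>)\<^sup>2)" for r
  define H where "H r = ?I (\<lambda>\<theta>. (ut r \<theta>)\<^sup>2)" for r
  have dF: "(F has_real_derivative G r + 2 / \<phi> r * H r) (at r)" if r: "r > 0" for r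
  proof -
    have "(F has_real_derivative ?I (\<lambda>\<theta>. 2 * \<phi> r * (ur r \<theta>)\<^sup>2 - 2 / \<phi> r * (U r \<theta> * utt r \<theta>))) (at r within {0<..})"
      unfolding F_def[abs_def]
    proof (rule leibniz_rule_field_derivative)
      fix s \<theta> :: real assume "s \<in> {0<..}"
      then have s: "s > 0" by simp
      have "((\<lambda>s. 2 * \<phi> s * U s \<theta> * ur s \<theta>) has_real_derivative
          2 * \<phi> s * (ur s \<theta>)\<^sup>2 + 2 * U s \<theta> * (\<phi> s * urr s \<theta> + deriv \<phi> s * ur s \<theta>)) (at s)"
        using cusp_radius_differentiable[of s, folded \<phi>_def]
        by (auto intro!: derivative_eq_intros dU urr simp: power2_eq_square algebra_simps)
      then show "((\<lambda>s. 2 * \<phi> s * U s \<theta> * ur s \<theta>) has_real_derivative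
          2 * \<phi> s * (ur s \<theta>)\<^sup>2 - 2 / \<phi> s * (U s \<theta> * utt s \<theta>)) (at s within {0<..})"
        unfolding eq[OF s] by (simp add: has_field_derivative_at_within mult_ac)
    next
      show "(\<lambda>\<theta>. 2 * \<phi> s * U s \<theta> * ur s \<theta>) integrable_on cbox 0 (2 * pi)" for s
        by (intro ion ci c\<phi>)
      show "continuous_on ({0<..} \<times> cbox 0 (2 * pi)) (\<lambda>(r, \<theta>). 2 * \<phi> r * (ur r \<theta>)\<^sup>2 - 2 / \<phi> r * (U r \<theta> * utt r \<theta>))"
        unfolding split_beta
        by (intro ci c\<phi>) (use \<phi> in \<open>auto simp: less_imp_neq[symmetric]\<close>)
    qed (use r in auto)
    also have "?I (\<lambda>\<theta>. 2 * \<phi> r * (ur r \<theta>)\<^sup>2 - 2 / \<phi> r * (U r \<theta> * utt r \<theta>))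
        = G r - ?I (\<lambda>\<theta>. 2 / \<phi> r * (U r \<theta> * utt r \<theta>))"
      unfolding G_def by (intro integral_diff ion ci c\<phi>)
    also have "\<dots> = G r - 2 / \<phi> r * (- H r)"
      by (simp only: integral_mult_right parts H_def)
    also have "\<dots> = G r + 2 / \<phi> r * H r" by simp
    also have "at r within {0<..} = at r" using r by (intro at_within_open) auto
    finally show ?thesis .
  qed
  have G: "G r \<ge> 0" if "r > 0" for r
    unfolding G_def using \<phi>[OF that] by (intro integral_nonneg ion ci c\<phi>) auto
  have H: "H r \<ge> 0" for r
    unfolding H_def by (intro integral_nonneg ion ci) auto
  have F': "G r + 2 / \<phi> r * H r \<ge> 0" if "r > 0" for r
    using G[OF that] H[of r] \<phi>[OF that] by simp
  have F0: "F 0 = 0" by (simp add: F_def \<phi>_def cusp_radius_def)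
  have cF: "continuous_on S F" for S
    unfolding F_def[abs_def] by (rule integral_continuous_on_param) (unfold split_beta, intro ci c\<phi>)
  \<comment> \<open>The derivative of \<open>F\<close> is known only at positive radii; continuity
    extends monotonicity to 0, where \<open>F\<close> vanishes.\<close>
  have mono: "F a \<le> F b" if "0 \<le> a" "a \<le> b" for a b
  proof (rule DERIV_nonneg_imp_increasing_open[OF that(2) _ cF])
    fix s assume "a < s" "s < b"
    then have "s > 0" using that by simp
    then show "\<exists>y. (F has_real_derivative y) (at s) \<and> 0 \<le> y" using dF F' by blast
  qed
  \<comment> \<open>A positive value persists outward by monotonicity, so E' = F/\<phi> grows at
    least exponentially, whereas \<open>E\<close> is at most a multiple of (1 + s)^(2d).\<close>
  have F: "F r = 0" if r: "r > 0" for r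
  proof (rule ccontr)
    assume "F r \<noteq> 0"
    then have Fr: "F r > 0" using mono[of 0 r] r F0 by simp
    show False
    proof (rule not_exp_growth_of_poly_bound)
      show "F r / 2 > 0" using Fr by simp
      show "r \<ge> 0" using r by simp
    next
      fix s assume s: "s \<ge> r"
      then have s0: "s > 0" using r by simp
      show "(E has_real_derivative F s / \<phi> s) (at s)" by (rule dE[OF s0])
      have "F r \<le> F s" using mono[of r s] r s by simp
      moreover have "\<phi> s \<le> 2 * exp (- s)" using cusp_radius_le[of s] s0 by (simp add: \<phi>_def)
      ultimately have "F r / (2 * exp (- s)) \<le> F s / \<phi> s"
        using Fr \<phi>[OF s0] by (intro frac_le) auto
      then show "F r / 2 * exp s \<le> F s / \<phi> s" by (simp add: exp_minus field_simps)
      have "E s \<le> ?I (\<lambda>\<theta>. (C * (1 + s) ^ d)\<^sup>2)"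
        unfolding E_def
      proof (intro integral_le ion ci)
        fix \<theta>
        have "\<bar>U s \<theta>\<bar> \<le> C * (1 + s) ^ d"
          using growth[of "polar s \<theta>"] s0 by (simp add: U_def norm_polar)
        then show "(U s \<theta>)\<^sup>2 \<le> (C * (1 + s) ^ d)\<^sup>2"
          by (metis abs_ge_zero power2_abs power_mono)
      qed
      also have "\<dots> = 2 * pi * C\<^sup>2 * (1 + s) ^ (2 * d)"
        by (simp add: power_mult_distrib power_mult[symmetric] mult.commute[of d])
      finally show "E s \<le> 2 * pi * C\<^sup>2 * (1 + s) ^ (2 * d)" .
    qed
  qed
  \<comment> \<open>The vanishing derivative of \<open>F\<close> is a sum of nonnegative terms, so
    \<open>G\<close> vanishes; its continuous nonnegative integrand is then zero at every angle of
    the interval.\<close>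
  have ur0: "ur r \<theta> = 0" if r: "r > 0" and \<theta>: "0 \<le> \<theta>" "\<theta> \<le> 2 * pi" for r \<theta>
  proof -
    have "(F has_real_derivative 0) (at r)"
      by (rule has_field_derivative_transform_within_open[of "\<lambda>_. 0" _ _ "{0<..}"]) (use F r in auto)
    then have "G r + 2 / \<phi> r * H r = 0" using dF[OF r] DERIV_unique by blast
    then have "G r = 0" using G[OF r] H[of r] \<phi>[OF r]
      by (metis add_nonneg_eq_0_iff divide_nonneg_pos mult_nonneg_nonneg zero_le_numeral)
    then have "integral {0..2 * pi} (\<lambda>\<theta>. 2 * \<phi> r * (ur r \<theta>)\<^sup>2) = 0"
      by (simp add: G_def)
    then have "\<forall>\<theta>\<in>{0..2 * pi}. 2 * \<phi> r * (ur r \<theta>)\<^sup>2 = 0"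
      by (subst (asm) integral_eq_0_iff) (use \<phi>[OF r] in \<open>auto intro!: ci c\<phi>\<close>)
    then have "2 * \<phi> r * (ur r \<theta>)\<^sup>2 = 0" using \<theta> by auto
    then show ?thesis using \<phi>[OF r] by simp
  qed
  \<comment> \<open>Along each ray \<open>u\<close> is constant, and all rays meet at the
    origin.\<close>
  obtain r \<theta> where x: "r \<ge> 0" "0 \<le> \<theta>" "\<theta> \<le> 2 * pi" "x = polar r \<theta>"
    by (rule ex_polar)
  have "U r \<theta> = U 0 \<theta>"
  proof (cases "r = 0")
    case False
    show ?thesis
    proof (rule DERIV_isconst2[where f = "\<lambda>r. U r \<theta>"])
      show "0 < r" using False x by simp
      show "continuous_on {0..r} (\<lambda>r. U r \<theta>)" by (intro ci)
      show "((\<lambda>r. U r \<theta>) has_real_derivative 0) (at s)" if "0 < s" "s < r" for s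
        using dU(1)[of \<theta> s] ur0[of s \<theta>] that x by simp
    qed (use x in auto)
  qed simp
  moreover have "polar 0 \<theta> = 0" by (simp add: vec_eq_iff forall_2)
  ultimately show ?thesis by (simp add: U_def x)
qed

lemma harmonic_const: "harmonic \<phi> (\<lambda>x. c)"
proof -
  have "(deriv ^^ 2) (\<lambda>s. c) r = 0" for c r :: real
    by (simp add: numeral_2_eq_2)
  then show ?thesis by (simp add: harmonic_def Ck_const laplacian_def)
qed

section \<open>The cusp metric as witness for the failure of doubling and both Liouville
  properties\<close>

theorem mainTheorem5:
  shows "\<exists>(\<phi> :: real \<Rightarrow> real) (g :: real ^ 2 \<Rightarrow> real ^ 2 ^ 2).
    riemannian_metric g \<and> riem_complete g \<and> rotationally_symmetric g \<phi> \<and>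
    \<not> (\<exists>\<kappa>::real. \<forall>p. \<forall>R>0.
          riem_vol g (riem_ball g p (2 * R)) \<le> ennreal \<kappa> * riem_vol g (riem_ball g p R)) \<and>
    (\<forall>u. harmonic \<phi> u \<and> bounded (range u) \<longrightarrow> u constant_on UNIV) \<and>
    (\<forall>d::nat. d > 0 \<longrightarrow> finite_dim (harmonic_growth g \<phi> d))"
proof (intro exI conjI allI impI)
  show "riemannian_metric cusp_metric" by (rule riemannian_cusp_metric)
  show "riem_complete cusp_metric" by (rule riem_complete_cusp)
  show "rotationally_symmetric cusp_metric cusp_radius" by (rule rotationally_symmetric_cusp)
  show "\<not> (\<exists>\<kappa>::real. \<forall>p. \<forall>R>0. riem_vol cusp_metric (riem_ball cusp_metric p (2 * R))
      \<le> ennreal \<kappa> * riem_vol cusp_metric (riem_ball cusp_metric p R))"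
    by (rule cusp_not_doubling)
next
  fix u assume u: "harmonic cusp_radius u \<and> bounded (range u)"
  then obtain C where "\<And>x. \<bar>u x\<bar> \<le> C" unfolding bounded_iff by auto
  then have "u x = u 0" for x
    using u harmonic_cusp_poly_growth_imp_const[of u C 0 x] by simp
  then show "u constant_on UNIV" unfolding constant_on_def by blast
next
  fix d :: nat assume "d > 0"
  let ?V = "harmonic_growth cusp_metric cusp_radius d"
  have dist: "riem_dist cusp_metric 0 x \<ge> 0" for x
    by (rule riem_dist_nonneg[OF riemannian_cusp_metric])
  then have "1 / (1 + riem_dist cusp_metric 0 x) ^ d \<le> 1" for x
    by (simp add: divide_le_eq one_le_power)
  \<comment> \<open>The weights are at least 1, so the constant function 1 belongs to the space; it
    will span it.\<close>
  then have one: "(\<lambda>x. 1) \<in> ?V"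
    by (auto simp: harmonic_growth_def harmonic_const intro!: bdd_aboveI2[where M = 1])
  have const: "u x = u 0" if u: "u \<in> ?V" for u x
  proof -
    obtain C where C: "\<And>x. \<bar>u x\<bar> / (1 + riem_dist cusp_metric 0 x) ^ d \<le> C"
      using u unfolding harmonic_growth_def bdd_above_def by auto
    \<comment> \<open>The sign of \<open>C\<close> allows the distance to be replaced by the larger
      Euclidean norm in the growth bound.\<close>
    have "C \<ge> 0" using C[of 0] dist[of 0] by (meson abs_ge_zero divide_nonneg_nonneg order_trans
          zero_le_power add_nonneg_nonneg zero_le_one)
    have "\<bar>u x\<bar> \<le> C * (1 + norm x) ^ d" for x
    proof -
      have "(1 + riem_dist cusp_metric 0 x) ^ d > 0"
        using dist[of x] by (intro zero_less_power add_pos_nonneg) auto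
      then have "\<bar>u x\<bar> \<le> C * (1 + riem_dist cusp_metric 0 x) ^ d"
        using C[of x] by (simp add: divide_le_eq)
      also have "\<dots> \<le> C * (1 + norm x) ^ d"
        using cusp_dist_le_norm[of 0 x] dist[of x] \<open>C \<ge> 0\<close> by (intro mult_left_mono power_mono) auto
      finally show ?thesis .
    qed
    moreover have "harmonic cusp_radius u" using u by (simp add: harmonic_growth_def)
    ultimately show ?thesis using harmonic_cusp_poly_growth_imp_const by blast
  qed
  have "\<exists>c. \<forall>x. u x = (\<Sum>b\<in>{\<lambda>x. 1}. c b * b x)" if "u \<in> ?V" for u
    using const[OF that] by (intro exI[of _ "\<lambda>b. u 0"]) simp
  with one show "finite_dim ?V"
    unfolding finite_dim_def by (intro exI[of _ "{\<lambda>x. 1}"]) auto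
qed

end
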